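(* Let $\Omega$ be a non-empty set, and let $A$ be an ordered Banach algebra of bounded $\mathbb F$-valued functions on $\Omega$, supplied with the supremum norm (and the pointwise ordering). Then $A$ has a positive $1$-bounded approximate identity. Let $\{e_\lambda\}_{\lambda\in\Lambda}$ be a positive $1$-bounded approximate identity of $A$. Let $X$ be an ordered Banach space with a closed positive cone, and let $\pi$ be a positive continuous representation of $A$ on $X$. Let $S$ be a non-empty subset of $X^+$ such that $\lim_\lambda\pi(e_\lambda)s=s$ uniformly on $S$. Let $B=\{g:\Omega\to\mathbb F : g\text{ is bounded and } gf\in A\text{ for all }f\in A\}$ be the normalizer of $A$ in the bounded functions on $\Omega$, supplied with the supremum norm (and the pointwise ordering). Then the unital ordered superalgebra $B$ of $A$ satisfies: (i) the restricted positive continuous representation $\pi_{\mathrm e}$ of $A$ on the essential subspace $X_{\mathrm e}$ extends to a positive continuous unital representation (again denoted $\pi_{\mathrm e}$) of $B$ on $X_{\mathrm e}$; (ii) $B^+$ is inverse closed in $B$, i.e. $b^{-1}\in B^+$ whenever $b\in B^+$ is invertible in $B$. Therefore, with $M=1$, for every $\epsilon>0$, every $\delta>0$, every $r$ with $0<r<(M+1)^{-1}=1/2$, every integer $n_0\geq1$, and every sequence $\{\alpha_n\}_{n=1}^\infty$ in $(1,\infty)$ with $\lim_{n\to\infty}\alpha_n=\infty$, there exists a simultaneous power factorization $(a,(x_n)_{n\geq1})$ (in the sense defined in the context) for $\sigma=\pi_{\mathrm e}$ on $Y=X_{\mathrm e}$, the non-empty subset $T=S$ of $X_{\mathrm e}$,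 the superalgebra $B$ and the parameters $\epsilon,\delta,r,n_0,\{\alpha_n\}$, such that in addition: (8) $a\in A^+$; (9) $x_n(S)\subset X_{\mathrm e}^+$ for all $n\geq1$; (10) one can take $M=1$ in part (2) of the definition in the context, i.e. $\|a\|\leq 1$.
   Context: All algebras and vector spaces are over $\mathbb F=\mathbb R$ or $\mathbb C$. Unit elements of unital normed algebras have norm $1$. A left approximate identity of bound $M$ for $A$ is a net $\{e_\lambda\}$ in $A$ with $\|e_\lambda\|\leq M$ and $\lim_\lambda e_\lambda a=a$ for all $a\in A$ (for a commutative algebra this is the same as an approximate identity); it is positive if all $e_\lambda\in A^+$. A continuous representation on $X$ is a norm-continuous algebra homomorphism into the bounded operators on $X$; it is unital if it maps the unit to the identity operator. Uniform convergence $\lim_\lambda\pi(e_\lambda)s=s$ on $S$: for every $\eta>0$ there is $\lambda_0$ with $\|\pi(e_\lambda)s-s\|<\eta$ for all $\lambda\geq\lambda_0$, $s\in S$. Order conventions: an ordered vector space $X$ is a (real or complex) vector space with a positive convex cone $X^+$; an ordered algebra is an algebra with a positive convex algebra cone $A^+$. Cones need not be proper, generating or closed unless stated. For an algebra of functions the positive cone consists of the functions in it with values in $[0,\infty)$. A representation $\pi$ of $A$ on $X$ is positive if $\pi(a)x\in X^+$ for $a\in A^+$, $x\in X^+$. A unital ordered Banach superalgebra $B$ of $A$ is a unital ordered Banach algebra containing $A$ as a closed subalgebra, with $A$ carrying the restricted norm and the inherited ordering. The essential subspace is $X_{\mathrm e}=\overline{\mathrm{Span}\{\pi(a)x:a\in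 A,x\in X\}}=\{x\in X:\lim_\lambda\pi(e_\lambda)x=x\}$, ordered by $X_{\mathrm e}^+=X_{\mathrm e}\cap X^+$ (so that $S\subset X_{\mathrm e}^+$); $\pi_{\mathrm e}$ is the restriction of $\pi$ to $X_{\mathrm e}$. Definition (simultaneous power factorization). Let $A$ be a Banach algebra with left approximate identity $\{e_\lambda\}_{\lambda\in\Lambda}$ of bound $M\ge1$, $B$ a unital Banach superalgebra of $A$, $\sigma$ a continuous unital representation of $B$ on a Banach space $Y$, $T\subset Y$ non-empty, $\epsilon,\delta>0$, $0<r<(M+1)^{-1}$, $n_0\geq 1$ an integer, $\{\alpha_n\}$ a sequence in $(1,\infty)$ tending to $\infty$. A simultaneous power factorization for these data consists of $a\in A$ and maps $x_n:T\to Y$ ($n\geq 1$) such that: (1) $s=\sigma(a^n)x_n(s)$ for all $n\geq 1$, $s\in T$; (2) $\|a\|\leq M$; (3) for all $n\geq1$, $x_n$ is a uniformly continuous homeomorphism of $T$ onto $x_n(T)$, with the restricted map $\sigma(a^n):x_n(T)\to T$ as its inverse; (4) (a) $\|s-x_n(s)\|\leq\epsilon$ for $1\leq n\leq n_0$ and $s\in T$; (b) $\|x_n(s)\|\leq\alpha_n^n\max(\|s\|,\delta)$ for all $n\geq1$, $s\in T$; (5) (a) if $s_1,s_2,s_1+s_2\in T$, then $x_n(s_1+s_2)=x_n(s_1)+x_n(s_2)$ for all $n\geq 1$; (b) if $\mu\in\mathbb F$ and $s,\mu s\in T$, then $x_n(\mu s)=\mu x_n(s)$ for all $n\geq 1$;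 (6) there is a sequence $\{u_i\}_{i=1}^\infty$ in $\{e_\lambda:\lambda\in\Lambda\}$ such that: (a) $a=\sum_{i=1}^\infty r(1-r)^{i-1}u_i$, an element of the closed convex hull of $\{u_i:i\geq1\}$ in $A$; (b) for every $k\geq0$, $b_k=(1-r)^k1_B+\sum_{i=1}^kr(1-r)^{i-1}u_i$ is an element of the convex hull of $\{1_B,u_1,\ldots,u_k\}$ in $B$ that is invertible in $B$, $b_k^{-1}$ lies in the unital Banach subalgebra of $B$ generated by $\{u_1,\ldots,u_k\}$ (smallest closed subalgebra containing these and $1_B$), and $x_n(s)=\lim_{k\to\infty}\sigma(b_k^{-n})s$ for all $n\geq1$, $s\in T$; (c) there is a chain $\lambda_1\leq\lambda_2\leq\ldots$ in $\Lambda$ with $u_k=e_{\lambda_k}$ for all $k\geq1$, where moreover $\lambda_1<\lambda_2<\ldots$ can be required if $\Lambda$ has no largest element; (7) (a) if $T$ is bounded, so is $x_n(T)$ for all $n\geq1$; (b) if $T$ is totally bounded, so is $x_n(T)$ for all $n\geq1$; (c) $\lim_\lambda\sigma(e_\lambda)x_n(s)=x_n(s)$ uniformly on $T$ for all $n\geq1$.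
   Formalization: The existence of a positive 1-bounded approximate identity is proved for A closed under complex conjugation (automatic over R); over C it fails in general, e.g. for disc-algebra functions vanishing at 0. The rest is proved for every A having such an approximate identity. *)

theory Defs
  imports "HOL-Analysis.Analysis" "HOL-Probability.Discrete_Topology"
begin

text \<open>
  The scalar field is a type \<open>'f :: {real_normed_field, banach}\<close>. Both \<open>real\<close> and \<open>complex\<close> are
  instances, and by the Gelfand--Mazur theorem there are no others up to isometric isomorphism.
  Conjugation is available uniformly, since the conjugate of \<open>z\<close> is \<open>\<bar>z\<bar>\<^sup>2 / z\<close>.
\<close>

definition conjugate :: "'f::real_normed_field \<Rightarrow> 'f" where
  "conjugate z = of_real ((norm z)\<^sup>2) / z"

lemma conjugate_real: "conjugate (x::real) = x"
  by (simp add: conjugate_def power2_eq_square)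

lemma conjugate_complex: "conjugate (z::complex) = cnj z"
proof (cases "z = 0")
  case False
  then show ?thesis
    unfolding conjugate_def by (simp only: complex_norm_square) simp
qed (simp add: conjugate_def)

text \<open>
  A library type \<open>'x :: banach\<close> is a real Banach space; \<open>sc\<close> makes it a Banach space over \<open>'f\<close>.
  For \<open>'f = real\<close> this forces \<open>sc = scaleR\<close>.
\<close>

definition normed_space_over :: "('f::real_normed_field \<Rightarrow> 'x::real_normed_vector \<Rightarrow> 'x) \<Rightarrow> bool" where
  "normed_space_over sc \<longleftrightarrow>
     vector_space sc \<and> (\<forall>r x. sc (of_real r) x = r *\<^sub>R x) \<and>
     (\<forall>c x. norm (sc c x) = norm c * norm x)"


definition directed_set :: "'l set \<Rightarrow> ('l \<Rightarrow> 'l \<Rightarrow> bool) \<Rightarrow> bool" where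
  "directed_set L le \<longleftrightarrow>
     L \<noteq> {} \<and> reflp_on L le \<and> transp_on L le \<and> (\<forall>i\<in>L. \<forall>j\<in>L. \<exists>k\<in>L. le i k \<and> le j k)"

definition net_filter :: "'l set \<Rightarrow> ('l \<Rightarrow> 'l \<Rightarrow> bool) \<Rightarrow> 'l filter" where
  "net_filter L le = (INF i\<in>L. principal {j\<in>L. le i j})"

lemma eventually_net_filter:
  assumes "directed_set L le"
  shows "eventually P (net_filter L le) \<longleftrightarrow> (\<exists>i\<in>L. \<forall>j\<in>L. le i j \<longrightarrow> P j)"
proof -
  have "eventually P (net_filter L le) \<longleftrightarrow> (\<exists>i\<in>L. eventually P (principal {j\<in>L. le i j}))"
    unfolding net_filter_def
  proof (rule eventually_INF_base)
    show "L \<noteq> {}" using assms by (simp add: directed_set_def)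
    fix i j assume ij: "i \<in> L" "j \<in> L"
    then obtain k where k: "k \<in> L" "le i k" "le j k"
      using assms unfolding directed_set_def by blast
    have "le i l \<and> le j l" if "l \<in> L" "le k l" for l
      using assms ij k that unfolding directed_set_def by (meson transp_onD)
    then show "\<exists>k\<in>L. principal {l\<in>L. le k l} \<le> inf (principal {l\<in>L. le i l}) (principal {l\<in>L. le j l})"
      using k(1) by (intro bexI[of _ k]) auto
  qed
  then show ?thesis by (auto simp: eventually_principal)
qed

definition left_approximate_identity ::
  "'a::real_normed_algebra set \<Rightarrow> real \<Rightarrow> 'l set \<Rightarrow> ('l \<Rightarrow> 'l \<Rightarrow> bool) \<Rightarrow> ('l \<Rightarrow> 'a) \<Rightarrow> bool" where
  "left_approximate_identity A M L le e \<longleftrightarrow>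
     directed_set L le \<and> (\<forall>l\<in>L. e l \<in> A \<and> norm (e l) \<le> M) \<and>
     (\<forall>a\<in>A. ((\<lambda>l. e l * a) \<longlongrightarrow> a) (net_filter L le))"

definition positive_left_approximate_identity ::
  "'a::real_normed_algebra set \<Rightarrow> 'a set \<Rightarrow> real \<Rightarrow> 'l set \<Rightarrow> ('l \<Rightarrow> 'l \<Rightarrow> bool) \<Rightarrow> ('l \<Rightarrow> 'a) \<Rightarrow> bool" where
  "positive_left_approximate_identity A AP M L le e \<longleftrightarrow>
     left_approximate_identity A M L le e \<and> (\<forall>l\<in>L. e l \<in> AP)"


text \<open>
  Algebras are subsets of an ambient type of class \<open>real_normed_algebra_1\<close> (so the unit has
  norm 1), \<open>sc\<close> is the multiplication by scalars of \<open>'f\<close>, and \<open>AP\<close> is the positive cone of \<open>A\<close>.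
\<close>

definition subalgebra_over ::
  "('f::field \<Rightarrow> 'a::real_normed_algebra_1 \<Rightarrow> 'a) \<Rightarrow> 'a set \<Rightarrow> bool" where
  "subalgebra_over sc A \<longleftrightarrow> module.subspace sc A \<and> (\<forall>a\<in>A. \<forall>b\<in>A. a * b \<in> A)"

definition ordered_banach_algebra ::
  "('f::field \<Rightarrow> 'a::real_normed_algebra_1 \<Rightarrow> 'a) \<Rightarrow> 'a set \<Rightarrow> 'a set \<Rightarrow> bool" where
  "ordered_banach_algebra sc A AP \<longleftrightarrow>
     subalgebra_over sc A \<and> complete A \<and>
     AP \<subseteq> A \<and> convex_cone AP \<and> (\<forall>a\<in>AP. \<forall>b\<in>AP. a * b \<in> AP)"

definition unital_ordered_superalgebra ::
  "('f::field \<Rightarrow> 'a::real_normed_algebra_1 \<Rightarrow> 'a) \<Rightarrow> 'a set \<Rightarrow> 'a set \<Rightarrow> 'a set \<Rightarrow> 'a set \<Rightarrow> bool" where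
  "unital_ordered_superalgebra sc B BP A AP \<longleftrightarrow>
     ordered_banach_algebra sc B BP \<and> 1 \<in> B \<and>
     ordered_banach_algebra sc A AP \<and> A \<subseteq> B \<and> closed A \<and> AP = A \<inter> BP"

definition invertible_in :: "'a::monoid_mult set \<Rightarrow> 'a \<Rightarrow> bool" where
  "invertible_in B b \<longleftrightarrow> b \<in> B \<and> (\<exists>c\<in>B. b * c = 1 \<and> c * b = 1)"

definition inverse_in :: "'a::monoid_mult set \<Rightarrow> 'a \<Rightarrow> 'a" where
  "inverse_in B b = (THE c. c \<in> B \<and> b * c = 1 \<and> c * b = 1)"

definition inverse_closed :: "'a::monoid_mult set \<Rightarrow> 'a set \<Rightarrow> bool" where
  "inverse_closed B BP \<longleftrightarrow> (\<forall>b\<in>BP. invertible_in B b \<longrightarrow> inverse_in B b \<in> BP)"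

definition generated_unital_banach_subalgebra ::
  "('f::field \<Rightarrow> 'a::real_normed_algebra_1 \<Rightarrow> 'a) \<Rightarrow> 'a set \<Rightarrow> 'a set \<Rightarrow> 'a set" where
  "generated_unital_banach_subalgebra sc B U =
     \<Inter>{C. C \<subseteq> B \<and> subalgebra_over sc C \<and> closed C \<and> 1 \<in> C \<and> U \<subseteq> C}"


text \<open>
  \<open>\<sigma>\<close> represents \<open>A\<close> on the Banach subspace \<open>Y\<close>; its values outside \<open>A\<close> and \<open>Y\<close> are irrelevant.
  The last clause is continuity of \<open>\<sigma>\<close> for the operator norm on bounded operators on \<open>Y\<close>.
\<close>

definition continuous_representation ::
  "('f::field \<Rightarrow> 'a::real_normed_algebra_1 \<Rightarrow> 'a) \<Rightarrow> 'a set \<Rightarrow>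
   ('f \<Rightarrow> 'x::real_normed_vector \<Rightarrow> 'x) \<Rightarrow> 'x set \<Rightarrow> ('a \<Rightarrow> 'x \<Rightarrow> 'x) \<Rightarrow> bool" where
  "continuous_representation scA A scX Y \<sigma> \<longleftrightarrow>
     module.subspace scX Y \<and> complete Y \<and>
     (\<forall>a\<in>A. (\<forall>y\<in>Y. \<sigma> a y \<in> Y) \<and>
            (\<forall>y\<in>Y. \<forall>z\<in>Y. \<sigma> a (y + z) = \<sigma> a y + \<sigma> a z) \<and>
            (\<forall>c. \<forall>y\<in>Y. \<sigma> a (scX c y) = scX c (\<sigma> a y)) \<and>
            (\<exists>K. \<forall>y\<in>Y. norm (\<sigma> a y) \<le> K * norm y)) \<and>
     (\<forall>a\<in>A. \<forall>b\<in>A. \<forall>y\<in>Y. \<sigma> (a + b) y = \<sigma> a y + \<sigma> b y) \<and>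
     (\<forall>c. \<forall>a\<in>A. \<forall>y\<in>Y. \<sigma> (scA c a) y = scX c (\<sigma> a y)) \<and>
     (\<forall>a\<in>A. \<forall>b\<in>A. \<forall>y\<in>Y. \<sigma> (a * b) y = \<sigma> a (\<sigma> b y)) \<and>
     (\<forall>a\<in>A. \<forall>\<eta>>0. \<exists>\<zeta>>0. \<forall>b\<in>A. norm (b - a) < \<zeta> \<longrightarrow>
        (\<forall>y\<in>Y. norm (\<sigma> b y - \<sigma> a y) \<le> \<eta> * norm y))"

definition unital_representation :: "'x set \<Rightarrow> ('a::monoid_mult \<Rightarrow> 'x \<Rightarrow> 'x) \<Rightarrow> bool" where
  "unital_representation Y \<sigma> \<longleftrightarrow> (\<forall>y\<in>Y. \<sigma> 1 y = y)"

definition positive_representation :: "'a set \<Rightarrow> 'x set \<Rightarrow> ('a \<Rightarrow> 'x \<Rightarrow> 'x) \<Rightarrow> bool" where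
  "positive_representation AP YP \<sigma> \<longleftrightarrow> (\<forall>a\<in>AP. \<forall>y\<in>YP. \<sigma> a y \<in> YP)"

definition essential_subspace ::
  "'a set \<Rightarrow> ('f::field \<Rightarrow> 'x::real_normed_vector \<Rightarrow> 'x) \<Rightarrow> ('a \<Rightarrow> 'x \<Rightarrow> 'x) \<Rightarrow> 'x set" where
  "essential_subspace A scX \<pi> = closure (module.span scX {\<pi> a x | a x. a \<in> A})"


text \<open>
  The maps \<open>x n\<close> and the sequences \<open>u\<close>, \<open>\<alpha>\<close> and \<open>l\<close> are indexed from 1; their values at
  index 0 play no role. As \<open>le\<close> is only a preorder, \<open>i < j\<close> means \<open>le i j \<and> \<not> le j i\<close>.
\<close>

definition simultaneous_power_factorization ::
  "('f::field \<Rightarrow> 'a::real_normed_algebra_1 \<Rightarrow> 'a) \<Rightarrow> 'a set \<Rightarrow> 'a set \<Rightarrow>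
   real \<Rightarrow> 'l set \<Rightarrow> ('l \<Rightarrow> 'l \<Rightarrow> bool) \<Rightarrow> ('l \<Rightarrow> 'a) \<Rightarrow>
   ('f \<Rightarrow> 'x::real_normed_vector \<Rightarrow> 'x) \<Rightarrow> 'x set \<Rightarrow> ('a \<Rightarrow> 'x \<Rightarrow> 'x) \<Rightarrow> 'x set \<Rightarrow>
   real \<Rightarrow> real \<Rightarrow> real \<Rightarrow> nat \<Rightarrow> (nat \<Rightarrow> real) \<Rightarrow> 'a \<Rightarrow> (nat \<Rightarrow> 'x \<Rightarrow> 'x) \<Rightarrow> bool" where
  "simultaneous_power_factorization scA A B M L le e scX Y \<sigma> T \<epsilon> \<delta> r n0 \<alpha> a x \<longleftrightarrow>
     a \<in> A \<and> (\<forall>n\<ge>1. \<forall>s\<in>T. x n s \<in> Y) \<and>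
     (\<forall>n\<ge>1. \<forall>s\<in>T. s = \<sigma> (a ^ n) (x n s)) \<and>
     norm a \<le> M \<and>
     (\<forall>n\<ge>1. uniformly_continuous_on T (x n) \<and> homeomorphism T (x n ` T) (x n) (\<sigma> (a ^ n))) \<and>
     (\<forall>n. 1 \<le> n \<and> n \<le> n0 \<longrightarrow> (\<forall>s\<in>T. norm (s - x n s) \<le> \<epsilon>)) \<and>
     (\<forall>n\<ge>1. \<forall>s\<in>T. norm (x n s) \<le> \<alpha> n ^ n * max (norm s) \<delta>) \<and>
     (\<forall>s\<^sub>1\<in>T. \<forall>s\<^sub>2\<in>T. s\<^sub>1 + s\<^sub>2 \<in> T \<longrightarrow> (\<forall>n\<ge>1. x n (s\<^sub>1 + s\<^sub>2) = x n s\<^sub>1 + x n s\<^sub>2)) \<and>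
     (\<forall>\<mu>. \<forall>s\<in>T. scX \<mu> s \<in> T \<longrightarrow> (\<forall>n\<ge>1. x n (scX \<mu> s) = scX \<mu> (x n s))) \<and>
     (\<exists>u l.
        (\<forall>k\<ge>1. l k \<in> L \<and> u k = e (l k)) \<and>
        (\<lambda>i. (r * (1 - r) ^ i) *\<^sub>R u (Suc i)) sums a \<and> a \<in> closure (convex hull (u ` {1..})) \<and>
        (\<forall>k. let b = (1 - r) ^ k *\<^sub>R 1 + (\<Sum>i=1..k. (r * (1 - r) ^ (i - 1)) *\<^sub>R u i) in
             b \<in> convex hull (insert 1 (u ` {1..k})) \<and> invertible_in B b \<and>
             inverse_in B b \<in> generated_unital_banach_subalgebra scA B (u ` {1..k})) \<and>
        (\<forall>n\<ge>1. \<forall>s\<in>T.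
           (\<lambda>k. \<sigma> (inverse_in B ((1 - r) ^ k *\<^sub>R 1 +
                     (\<Sum>i=1..k. (r * (1 - r) ^ (i - 1)) *\<^sub>R u i)) ^ n) s) \<longlonglongrightarrow> x n s) \<and>
        (\<forall>k\<ge>1. le (l k) (l (Suc k))) \<and>
        ((\<nexists>m. m \<in> L \<and> (\<forall>i\<in>L. le i m)) \<longrightarrow> (\<forall>k\<ge>1. \<not> le (l (Suc k)) (l k)))) \<and>
     (\<forall>n\<ge>1. bounded T \<longrightarrow> bounded (x n ` T)) \<and>
     (\<forall>n\<ge>1. totally_bounded T \<longrightarrow> totally_bounded (x n ` T)) \<and>
     (\<forall>n\<ge>1. uniform_limit T (\<lambda>i s. \<sigma> (e i) (x n s)) (x n) (net_filter L le))"


text \<open>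
  The bounded \<open>'f\<close>-valued functions on a set \<open>'w\<close>, with the supremum norm, are the elements of
  the library type \<open>'w discrete \<Rightarrow>\<^sub>C 'f\<close>, as every function on a discrete space is continuous.
  The library does not provide the pointwise multiplication.
\<close>

instantiation bcontfun :: (topological_space, real_normed_algebra_1) real_normed_algebra_1
begin

unbundle bcontfun.lifting

lemma times_bcontfun_closed:
  "f \<in> bcontfun \<Longrightarrow> g \<in> bcontfun \<Longrightarrow> (\<lambda>x. f x * g x) \<in> bcontfun" for f g :: "'a \<Rightarrow> 'b"
proof -
  assume f: "f \<in> bcontfun" and g: "g \<in> bcontfun"
  obtain K where K: "\<And>x. norm (f x) \<le> K"
    using f by (auto simp: bcontfun_def bounded_iff)
  obtain N where N: "\<And>x. norm (g x) \<le> N"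
    using g by (auto simp: bcontfun_def bounded_iff)
  have "norm (f x * g x) \<le> K * N" for x
    using norm_mult_ineq[of "f x" "g x"] mult_mono[OF K[of x] N[of x]] norm_ge_zero[of "f x"] K[of x]
    by (meson norm_ge_zero order_trans)
  then show ?thesis
    using f g by (intro bcontfun_normI) (auto simp: bcontfun_def intro!: continuous_intros)
qed

lift_definition times_bcontfun :: "('a \<Rightarrow>\<^sub>C 'b) \<Rightarrow> ('a \<Rightarrow>\<^sub>C 'b) \<Rightarrow> 'a \<Rightarrow>\<^sub>C 'b" is "\<lambda>f g x. f x * g x"
  by (rule times_bcontfun_closed)

lift_definition one_bcontfun :: "'a \<Rightarrow>\<^sub>C 'b" is "\<lambda>_. 1"
  by (rule const_bcontfun)

instance
proof
  fix f g h :: "'a \<Rightarrow>\<^sub>C 'b" and r :: real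
  show "f * g * h = f * (g * h)" "(f + g) * h = f * h + g * h" "f * (g + h) = f * g + f * h"
    "(r *\<^sub>R f) * g = r *\<^sub>R (f * g)" "f * (r *\<^sub>R g) = r *\<^sub>R (f * g)" "1 * f = f" "f * 1 = f"
    by (rule bcontfun_eqI, simp add: times_bcontfun.rep_eq one_bcontfun.rep_eq algebra_simps)+
  have "apply_bcontfun (0 :: 'a \<Rightarrow>\<^sub>C 'b) undefined \<noteq> apply_bcontfun 1 undefined"
    by (simp add: one_bcontfun.rep_eq)
  then show "(0 :: 'a \<Rightarrow>\<^sub>C 'b) \<noteq> 1" by metis
  show "norm (f * g) \<le> norm f * norm g"
  proof (rule norm_bound)
    fix x
    have "norm (apply_bcontfun (f * g) x) \<le> norm (apply_bcontfun f x) * norm (apply_bcontfun g x)"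
      by (simp add: times_bcontfun.rep_eq norm_mult_ineq)
    also have "\<dots> \<le> norm f * norm g"
      by (intro mult_mono norm_bounded norm_ge_zero)
    finally show "norm (apply_bcontfun (f * g) x) \<le> norm f * norm g" .
  qed
  show "norm (1 :: 'a \<Rightarrow>\<^sub>C 'b) = 1"
  proof (rule antisym)
    show "norm (1 :: 'a \<Rightarrow>\<^sub>C 'b) \<le> 1" by (rule norm_bound) (simp add: one_bcontfun.rep_eq)
    show "1 \<le> norm (1 :: 'a \<Rightarrow>\<^sub>C 'b)"
      using norm_bounded[of "1 :: 'a \<Rightarrow>\<^sub>C 'b" undefined] by (simp add: one_bcontfun.rep_eq)
  qed
qed

end

declare times_bcontfun.rep_eq [simp] one_bcontfun.rep_eq [simp]

lemma bounded_function_bcontfun: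
  fixes f :: "'w discrete \<Rightarrow> 'f::metric_space"
  assumes "bounded (range f)"
  shows "apply_bcontfun (Bcontfun f) = f"
  using assms
  by (intro Bcontfun_inverse) (auto simp: bcontfun_def continuous_on_open_vimage open_discrete)

lemma norm_bounded_function:
  fixes f :: "'w discrete \<Rightarrow>\<^sub>C 'f::real_normed_vector"
  shows "norm f = (SUP w. norm (f w))"
  by (simp add: norm_bcontfun_def dist_bcontfun.rep_eq)

definition scale_fun :: "'f::real_normed_field \<Rightarrow> ('w discrete \<Rightarrow>\<^sub>C 'f) \<Rightarrow> ('w discrete \<Rightarrow>\<^sub>C 'f)" where
  "scale_fun c f = const_bcontfun c * f"

lemma scale_fun_apply: "apply_bcontfun (scale_fun c f) w = c * apply_bcontfun f w"
  by (simp add: scale_fun_def)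

definition nonneg_cone :: "('w discrete \<Rightarrow>\<^sub>C 'f::real_normed_field) set \<Rightarrow> ('w discrete \<Rightarrow>\<^sub>C 'f) set" where
  "nonneg_cone A = {f\<in>A. \<forall>w. apply_bcontfun f w \<in> of_real ` {0..}}"

definition normalizer :: "('w discrete \<Rightarrow>\<^sub>C 'f::real_normed_field) set \<Rightarrow> ('w discrete \<Rightarrow>\<^sub>C 'f) set" where
  "normalizer A = {g. \<forall>f\<in>A. g * f \<in> A}"

definition self_adjoint :: "('w discrete \<Rightarrow>\<^sub>C 'f::real_normed_field) set \<Rightarrow> bool" where
  "self_adjoint A \<longleftrightarrow> (\<forall>f\<in>A. \<exists>g\<in>A. \<forall>w. apply_bcontfun g w = conjugate (apply_bcontfun f w))"

lemma self_adjoint_real: "self_adjoint (A :: ('w discrete \<Rightarrow>\<^sub>C real) set)"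
  by (auto simp: self_adjoint_def conjugate_real)

end

theory Submission
  imports Defs
begin

text \<open>
  As \<open>A\<close> is an algebra of functions, the positive elements \<open>u\<^sub>i = e\<^sub>\<lambda>\<close> take values in \<open>[0, 1]\<close>, so
  \<open>b\<^sub>k = (1 - r)\<^sup>k + \<Sum>i\<le>k. r (1 - r)\<^sup>i\<^sup>-\<^sup>1 u\<^sub>i\<close> takes values in \<open>[(1 - r)\<^sup>k, 1]\<close> and its inverse is a positive
  function bounded by \<open>(1 - r)\<^sup>-\<^sup>k\<close>. By commutativity \<open>b\<^sub>k\<^sub>+\<^sub>1\<^sup>-\<^sup>n - b\<^sub>k\<^sup>-\<^sup>n\<close> is a multiple of \<open>1 - u\<^sub>k\<^sub>+\<^sub>1\<close>
  with a cofactor bounded in terms of \<open>n\<close>, \<open>k\<close> and \<open>r\<close> only. Hence \<open>\<sigma>(b\<^sub>k\<^sup>-\<^sup>n) s\<close> converges, uniformly in \<open>s \<in> S\<close>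
  and as fast as desired, once the \<open>u\<^sub>i\<close> approximate the identity on \<open>S\<close> well enough. The bounds
  by \<open>\<alpha> n ^ n\<close> hold because the movement is controlled for the \<open>n\<close>-th power only from the stage \<open>k\<close> on
  at which \<open>(1 - r)\<^sup>-\<^sup>k\<close> is about to exceed \<open>\<alpha> n\<close>.
\<close>

section \<open>Algebras of bounded functions\<close>

text \<open>The algebra \<open>A\<close> need not contain 1 or any inverses, so the representation
  is moved to the normalizer \<open>B\<close>: an element b acts on \<open>Xe\<close> as the limit
  of the operators \<open>\<pi> (b * e i)\<close>. These limits exist because the operators are
  bounded independently of i and converge on the dense set of vectors \<open>\<pi> (e j) y\<close>.
  The obstacle in the iteration is that one sequence \<open>u\<close> has to serve all exponents n,
  while an error at stage k is magnified by a factor of order (1 - r)^(-2kn), which is unbounded in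
  n. No single \<open>u (Suc k)\<close> could be good enough for every n, and this forces the
  delayed start of control for large n. Existence of an approximate identity is a separate matter:
  it consists of the functions h / (1 + h) with h in the positive cone.\<close>

instance bcontfun :: (metric_space, banach) banach ..

instance bcontfun :: (topological_space, real_normed_field) comm_ring_1
  by standard (auto intro!: bcontfun_eqI simp: algebra_simps)

lemma tendsto_apply_bcontfun:
  assumes "(f \<longlongrightarrow> g) F"
  shows "((\<lambda>i. apply_bcontfun (f i) w) \<longlongrightarrow> apply_bcontfun g w) F"
  using tendsto_bcontfun_uniform_limit[OF assms] by (rule tendsto_uniform_limitI) simp

lemma apply_bcontfun_sum: "apply_bcontfun (\<Sum>i\<in>I. f i) w = (\<Sum>i\<in>I. apply_bcontfun (f i) w)"
  by (induction I rule: infinite_finite_induct) auto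

lemma scaleR_field: "t *\<^sub>R x = of_real t * x" for x :: "'f::real_normed_field"
  by (rule scaleR_conv_of_real)

lemma module_scale_fun: "module (scale_fun :: 'f::real_normed_field \<Rightarrow> ('w discrete \<Rightarrow>\<^sub>C 'f) \<Rightarrow> _)"
  by standard (auto intro!: bcontfun_eqI simp: scale_fun_apply algebra_simps)

lemma scale_fun_of_real: "scale_fun (of_real t) f = t *\<^sub>R f"
  by (rule bcontfun_eqI) (simp add: scale_fun_apply scaleR_field)

lemma scale_fun_mult: "scale_fun c f * g = scale_fun c (f * g)" "f * scale_fun c g = scale_fun c (f * g)"
  by (rule bcontfun_eqI, simp add: scale_fun_apply ac_simps)+

lemma normed_space_over_module: "normed_space_over sc \<Longrightarrow> module sc"
  unfolding normed_space_over_def by (simp add: module_iff_vector_space)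

lemma subalgebra_over_scale_fun:
  "subalgebra_over scale_fun A \<longleftrightarrow> 0 \<in> A \<and> (\<forall>f\<in>A. \<forall>g\<in>A. f + g \<in> A) \<and>
     (\<forall>c. \<forall>f\<in>A. scale_fun c f \<in> A) \<and> (\<forall>f\<in>A. \<forall>g\<in>A. f * g \<in> A)"
  unfolding subalgebra_over_def module.subspace_def[OF module_scale_fun] by blast

lemma
  assumes "subalgebra_over scale_fun A"
  shows subalgebra_zero: "0 \<in> A"
    and subalgebra_add: "f \<in> A \<Longrightarrow> g \<in> A \<Longrightarrow> f + g \<in> A"
    and subalgebra_mult: "f \<in> A \<Longrightarrow> g \<in> A \<Longrightarrow> f * g \<in> A"
    and subalgebra_scaleR: "f \<in> A \<Longrightarrow> t *\<^sub>R f \<in> A"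
    and subalgebra_diff: "f \<in> A \<Longrightarrow> g \<in> A \<Longrightarrow> f - g \<in> A"
proof -
  show "f \<in> A \<Longrightarrow> t *\<^sub>R f \<in> A" for f t
    using assms unfolding subalgebra_over_scale_fun by (metis scale_fun_of_real)
  from this[of g "-1"] show "f \<in> A \<Longrightarrow> g \<in> A \<Longrightarrow> f - g \<in> A"
    using assms unfolding subalgebra_over_scale_fun by (metis diff_conv_add_uminus scaleR_minus1_left)
qed (use assms in \<open>auto simp: subalgebra_over_scale_fun\<close>)

lemma subalgebra_sum:
  assumes "subalgebra_over scale_fun A" and "\<And>i. i \<in> I \<Longrightarrow> f i \<in> A"
  shows "(\<Sum>i\<in>I. f i) \<in> A"
  using assms(2)
  by (induction I rule: infinite_finite_induct)
     (auto intro: subalgebra_zero[OF assms(1)] subalgebra_add[OF assms(1)])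

lemma subalgebra_power:
  assumes "subalgebra_over scale_fun A" and "1 \<in> A" and "f \<in> A"
  shows "f ^ n \<in> A"
  by (induction n) (use assms subalgebra_mult[OF assms(1)] in auto)

section \<open>The normalizer as a closed unital algebra\<close>

lemma subalgebra_normalizer:
  assumes "subalgebra_over scale_fun A"
  shows "subalgebra_over scale_fun (normalizer A)"
  using assms unfolding subalgebra_over_scale_fun normalizer_def
  by (auto simp: scale_fun_mult distrib_right mult.assoc)

lemma subset_normalizer: "subalgebra_over scale_fun A \<Longrightarrow> A \<subseteq> normalizer A"
  by (auto simp: normalizer_def subalgebra_over_scale_fun)

lemma one_in_normalizer: "1 \<in> normalizer A"
  by (simp add: normalizer_def)

lemma closed_normalizer:
  assumes "closed A"
  shows "closed (normalizer A)"
proof -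
  have "normalizer A = (\<Inter>f\<in>A. (\<lambda>g. g * f) -` A)"
    by (auto simp: normalizer_def)
  moreover have "closed ((\<lambda>g. g * f) -` A)" for f
    by (rule closed_vimage[OF assms]) (intro continuous_intros)
  ultimately show ?thesis
    by auto
qed

section \<open>The cone of nonnegative functions\<close>

lemma nonneg_cone_norm:
  assumes "f \<in> nonneg_cone A"
  shows "apply_bcontfun f w = of_real (norm (apply_bcontfun f w))"
proof -
  have "apply_bcontfun f w \<in> of_real ` {0..}"
    using assms by (simp add: nonneg_cone_def)
  then show ?thesis
    by auto
qed

lemma nonneg_coneD:
  assumes "f \<in> nonneg_cone A"
  obtains t where "\<And>w. 0 \<le> t w" and "\<And>w. apply_bcontfun f w = of_real (t w)" and "\<And>w. t w \<le> norm f"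
  by (rule that[of "\<lambda>w. norm (apply_bcontfun f w)"]) (use nonneg_cone_norm[OF assms] norm_bounded[of f] in auto)

lemma nonneg_coneI:
  assumes "f \<in> A" and "\<And>w. 0 \<le> t w" and "\<And>w. apply_bcontfun f w = of_real (t w)"
  shows "f \<in> nonneg_cone A"
  using assms by (auto simp: nonneg_cone_def)

lemma convex_cone_nonneg_cone:
  assumes "subalgebra_over scale_fun A"
  shows "convex_cone (nonneg_cone A)"
  unfolding convex_cone_iff
proof (intro conjI ballI allI impI)
  show "0 \<in> nonneg_cone A"
    by (rule nonneg_coneI[where t = "\<lambda>_. 0"]) (auto intro: subalgebra_zero[OF assms])
next
  fix f g assume fg: "f \<in> nonneg_cone A" "g \<in> nonneg_cone A"
  obtain t where t: "\<And>w. 0 \<le> t w" "\<And>w. apply_bcontfun f w = of_real (t w)"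
    using nonneg_coneD[OF fg(1)] by metis
  obtain t' where t': "\<And>w. 0 \<le> t' w" "\<And>w. apply_bcontfun g w = of_real (t' w)"
    using nonneg_coneD[OF fg(2)] by metis
  show "f + g \<in> nonneg_cone A"
    by (rule nonneg_coneI[where t = "\<lambda>w. t w + t' w"])
       (use fg t t' subalgebra_add[OF assms] in \<open>auto simp: nonneg_cone_def\<close>)
next
  fix f and c :: real assume f: "f \<in> nonneg_cone A" and c: "0 \<le> c"
  obtain t where t: "\<And>w. 0 \<le> t w" "\<And>w. apply_bcontfun f w = of_real (t w)"
    using nonneg_coneD[OF f] by metis
  show "c *\<^sub>R f \<in> nonneg_cone A"
    by (rule nonneg_coneI[where t = "\<lambda>w. c * t w"])
       (use f c t subalgebra_scaleR[OF assms] in \<open>auto simp: nonneg_cone_def scaleR_field\<close>)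
qed

lemma nonneg_cone_mult:
  assumes fg: "f \<in> nonneg_cone A" "g \<in> nonneg_cone B" and "f * g \<in> C"
  shows "f * g \<in> nonneg_cone C"
proof -
  obtain t where t: "\<And>w. 0 \<le> t w" "\<And>w. apply_bcontfun f w = of_real (t w)"
    using nonneg_coneD[OF fg(1)] by metis
  obtain t' where t': "\<And>w. 0 \<le> t' w" "\<And>w. apply_bcontfun g w = of_real (t' w)"
    using nonneg_coneD[OF fg(2)] by metis
  show "f * g \<in> nonneg_cone C"
    by (rule nonneg_coneI[where t = "\<lambda>w. t w * t' w"]) (use assms(3) t t' in auto)
qed

lemma nonneg_cone_power:
  assumes "subalgebra_over scale_fun A" and "1 \<in> A" and "f \<in> nonneg_cone A"
  shows "f ^ n \<in> nonneg_cone A"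
proof (induction n)
  case 0
  show ?case
    by (rule nonneg_coneI[where t = "\<lambda>_. 1"]) (use assms in auto)
next
  case (Suc n)
  then show ?case
    using assms(3) subalgebra_mult[OF assms(1), of f "f ^ n"]
      nonneg_cone_mult[of f A "f ^ n" A A] by (simp add: nonneg_cone_def)
qed

lemma closed_nonneg_cone:
  assumes "closed A"
  shows "closed (nonneg_cone A)"
proof -
  have "f \<in> nonneg_cone A" if "\<And>n. f' n \<in> nonneg_cone A" "f' \<longlonglongrightarrow> f" for f' f
  proof (rule nonneg_coneI)
    show "f \<in> A"
      using that assms unfolding nonneg_cone_def closed_sequential_limits by blast
    fix w
    have *: "apply_bcontfun (f' n) w = of_real (norm (apply_bcontfun (f' n) w))" for n
      by (rule nonneg_cone_norm[OF that(1)])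
    \<comment> \<open>Being the image of a nonnegative real is the equation z =
      \<open>of_real (norm z)\<close>, both sides of which are continuous in z.\<close>
    have "(\<lambda>n. apply_bcontfun (f' n) w) \<longlonglongrightarrow> of_real (norm (apply_bcontfun f w))"
      by (subst *) (intro tendsto_intros tendsto_apply_bcontfun that)
    then show "apply_bcontfun f w = of_real (norm (apply_bcontfun f w))"
      using tendsto_apply_bcontfun[OF that(2)] LIMSEQ_unique by blast
  qed auto
  then show ?thesis
    by (auto simp: closed_sequential_limits)
qed

lemma ordered_banach_algebra_nonneg_cone:
  fixes A :: "('w discrete \<Rightarrow>\<^sub>C 'f::{real_normed_field,banach}) set"
  assumes "subalgebra_over scale_fun A" and "closed A"
  shows "ordered_banach_algebra scale_fun A (nonneg_cone A)"
  unfolding ordered_banach_algebra_def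
proof (intro conjI ballI)
  show "complete A" using assms(2) by (simp add: complete_eq_closed)
  show "nonneg_cone A \<subseteq> A" by (auto simp: nonneg_cone_def)
  show "f * g \<in> nonneg_cone A" if "f \<in> nonneg_cone A" "g \<in> nonneg_cone A" for f g
    using that subalgebra_mult[OF assms(1), of f g] nonneg_cone_mult[of f A g A A] by (simp add: nonneg_cone_def)
qed (use assms convex_cone_nonneg_cone in auto)

section \<open>Inverses and the Neumann series\<close>

lemma inverse_in_eqI:
  fixes b :: "'a::monoid_mult"
  assumes "c \<in> B" "b * c = 1" "c * b = 1"
  shows "inverse_in B b = c"
  unfolding inverse_in_def
proof (rule the_equality)
  fix d assume "d \<in> B \<and> b * d = 1 \<and> d * b = 1"
  then have "d = d * (b * c)" "d * b * c = c" using assms by auto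
  then show "d = c" by (simp add: mult.assoc)
qed (use assms in auto)

text \<open>An inverse in an algebra of functions is the pointwise reciprocal, and reciprocals of
  positive reals are positive.\<close>

lemma inverse_closed_nonneg_cone: "inverse_closed B (nonneg_cone B)"
  unfolding inverse_closed_def
proof (intro ballI impI)
  fix b assume b: "b \<in> nonneg_cone B" and "invertible_in B b"
  then obtain c where c: "c \<in> B" "b * c = 1" "c * b = 1"
    by (auto simp: invertible_in_def)
  obtain t where t: "\<And>w. 0 \<le> t w" "\<And>w. apply_bcontfun b w = of_real (t w)"
    using nonneg_coneD[OF b] by metis
  have "c \<in> nonneg_cone B"
  proof (rule nonneg_coneI)
    fix w
    have "apply_bcontfun b w * apply_bcontfun c w = 1"
      using c(2) by (metis one_bcontfun.rep_eq times_bcontfun.rep_eq)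
    then show "apply_bcontfun c w = of_real (inverse (t w))"
      by (metis inverse_unique of_real_inverse t(2))
  qed (use c t in auto)
  then show "inverse_in B b \<in> nonneg_cone B"
    using c by (simp add: inverse_in_eqI)
qed

text \<open>The Neumann series of 1 - b has its partial sums in the closed set \<open>C\<close>. As
  \<open>C\<close> is arbitrary, this later locates an inverse in the subalgebra generated by
  finitely many elements.\<close>

lemma inverse_in_closed_subalgebra:
  fixes b :: "'w discrete \<Rightarrow>\<^sub>C 'f::{real_normed_field,banach}"
  assumes "subalgebra_over scale_fun C" "closed C" "1 \<in> C" "b \<in> C" "norm (1 - b) < 1"
  obtains c where "c \<in> C" "b * c = 1" "c * b = 1"
proof
  define c where "c = (\<Sum>j. (1 - b) ^ j)"
  have sm: "summable (\<lambda>j. (1 - b) ^ j)"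
    using assms(5) by (rule complete_algebra_summable_geometric)
  then have "(\<lambda>n. \<Sum>j<n. (1 - b) ^ j) \<longlonglongrightarrow> c"
    unfolding c_def by (rule summable_LIMSEQ)
  then show "c \<in> C"
    using assms(2) unfolding closed_sequential_limits
    by (elim allE[of _ "\<lambda>n. \<Sum>j<n. (1 - b) ^ j"] allE[of _ c])
       (auto intro!: subalgebra_sum subalgebra_power subalgebra_diff assms)
  have "(1 - b) * c = (\<Sum>j. (1 - b) ^ Suc j)"
    unfolding c_def using sm by (simp add: suminf_mult)
  also have "\<dots> = c - 1"
    unfolding c_def using suminf_split_head[OF sm] by simp
  finally show "b * c = 1"
    by (simp add: algebra_simps)
  then show "c * b = 1"
    by (simp add: mult.commute)
qed

text \<open>The functions h / (1 + h) are indexed by the positive cone under its own order. The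
  error f / (1 + h) is small once h dominates a large multiple of |f|^2, and self-adjointness puts
  |f|^2 into \<open>A\<close>. The complex functions on the closed disc that are continuous,
  holomorphic inside and zero at 0 show what can go wrong: their only positive element is 0.\<close>

lemma positive_left_approximate_identity_exists:
  fixes A :: "('w discrete \<Rightarrow>\<^sub>C 'f::{real_normed_field,banach}) set"
  assumes sub: "subalgebra_over scale_fun A" and cl: "closed A" and sa: "self_adjoint A"
  shows "\<exists>(\<Lambda> :: ('w discrete \<Rightarrow>\<^sub>C 'f) set) leq u.
           positive_left_approximate_identity A (nonneg_cone A) 1 \<Lambda> leq u"
proof -
  let ?P = "nonneg_cone A"
  note cone = convex_cone_nonneg_cone[OF sub]
  have "\<exists>u\<in>?P. norm u \<le> 1 \<and> (\<forall>w. apply_bcontfun u w = apply_bcontfun h w / (1 + apply_bcontfun h w))"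
    if h: "h \<in> ?P" for h
  proof -
    obtain t where t: "\<And>w. 0 \<le> t w" "\<And>w. apply_bcontfun h w = of_real (t w)" "\<And>w. t w \<le> norm h"
      using nonneg_coneD[OF h] by metis
    \<comment> \<open>Scaling 1 + h by k brings its values into [k, 1], so that 1 - b has norm at
      most 1 - k and the Neumann series applies.\<close>
    define k where "k = 1 / (1 + norm h)"
    have k: "0 < k" "k \<le> 1" by (auto simp: k_def add_pos_nonneg)
    define b where "b = k *\<^sub>R (1 + h)"
    have "norm (apply_bcontfun (1 - b) w) \<le> 1 - k" for w
    proof -
      have "apply_bcontfun (1 - b) w = of_real (1 - k * (1 + t w))"
        by (simp add: b_def t scaleR_field algebra_simps)
      moreover have "k * (1 + t w) \<le> k * (1 + norm h)"
        using k t(3)[of w] by (intro mult_left_mono) auto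
      then have "k * (1 + t w) \<le> 1" by (simp add: k_def add_nonneg_eq_0_iff)
      moreover have "k \<le> k * (1 + t w)" using k t(1)[of w] by (simp add: distrib_left)
      ultimately show ?thesis by (simp del: of_real_diff of_real_mult of_real_add)
    qed
    then have "norm (1 - b) \<le> 1 - k"
      by (rule norm_bound)
    then have "norm (1 - b) < 1"
      using k by linarith
    moreover have "h \<in> normalizer A"
      using h subset_normalizer[OF sub] by (auto simp: nonneg_cone_def)
    then have "b \<in> normalizer A"
      unfolding b_def using subalgebra_normalizer[OF sub]
      by (intro subalgebra_scaleR subalgebra_add one_in_normalizer)
    ultimately obtain c where c: "c \<in> normalizer A" "b * c = 1"
      using inverse_in_closed_subalgebra subalgebra_normalizer[OF sub] closed_normalizer[OF cl] one_in_normalizer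
      by metis
    \<comment> \<open>As c inverts k (1 + h), the factor k cancels and this is h / (1 + h). It lies
      in \<open>A\<close>, although c need not, because c is in the normalizer.\<close>
    define u where "u = k *\<^sub>R (c * h)"
    have u: "apply_bcontfun u w = of_real (t w / (1 + t w))" for w
    proof -
      have "1 + t w \<noteq> 0" using t(1)[of w] by linarith
      then have nz: "1 + (of_real (t w) :: 'f) \<noteq> 0"
        by (metis of_real_1 of_real_add of_real_eq_0_iff)
      have "apply_bcontfun (b * c) w = 1" using c by simp
      then have "of_real k * (1 + of_real (t w)) * apply_bcontfun c w = 1"
        by (simp add: b_def t scaleR_field mult.assoc)
      then have "of_real k * apply_bcontfun c w = 1 / (1 + of_real (t w))"
        using nz by (simp add: field_simps)
      moreover have "apply_bcontfun u w = of_real k * apply_bcontfun c w * of_real (t w)"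
        by (simp add: u_def t scaleR_field)
      ultimately show ?thesis
        by simp
    qed
    have "u \<in> ?P"
    proof (rule nonneg_coneI[where t = "\<lambda>w. t w / (1 + t w)"])
      show "u \<in> A"
        unfolding u_def using c h by (intro subalgebra_scaleR[OF sub]) (auto simp: normalizer_def nonneg_cone_def)
    qed (use t u in auto)
    moreover have "norm u \<le> 1"
    proof (rule norm_bound)
      fix w
      show "norm (apply_bcontfun u w) \<le> 1"
        unfolding u norm_of_real using t(1)[of w] by (simp add: divide_le_eq_1)
    qed
    ultimately show ?thesis by (intro bexI[of _ u]) (auto simp: u t)
  qed
  then obtain u where u: "\<And>h. h \<in> ?P \<Longrightarrow> u h \<in> ?P" "\<And>h. h \<in> ?P \<Longrightarrow> norm (u h) \<le> 1"
      "\<And>h w. h \<in> ?P \<Longrightarrow> apply_bcontfun (u h) w = apply_bcontfun h w / (1 + apply_bcontfun h w)"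
    by metis
  define leq where "leq = (\<lambda>g h. h - g \<in> ?P)"
  have dir: "directed_set ?P leq"
    unfolding directed_set_def
  proof (intro conjI ballI)
    show "?P \<noteq> {}" using cone by (simp add: convex_cone_nonempty)
    show "reflp_on ?P leq"
      using cone by (auto simp: reflp_on_def leq_def convex_cone_contains_0)
    have "h - f \<in> ?P" if "g - f \<in> ?P" "h - g \<in> ?P" for f g h
      using convex_cone_add[OF cone that] by simp
    then show "transp_on ?P leq"
      unfolding transp_on_def leq_def by blast
    show "\<exists>k\<in>?P. leq g k \<and> leq h k" if "g \<in> ?P" "h \<in> ?P" for g h
      using convex_cone_add[OF cone that] that by (intro bexI[of _ "g + h"]) (auto simp: leq_def)
  qed
  have "((\<lambda>h. u h * f) \<longlongrightarrow> f) (net_filter ?P leq)" if f: "f \<in> A" for f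
  proof (rule tendstoI)
    fix \<eta> :: real assume \<eta>: "0 < \<eta>"
    obtain f' where f': "f' \<in> A" "\<And>w. apply_bcontfun f' w = conjugate (apply_bcontfun f w)"
      using sa f by (auto simp: self_adjoint_def)
    \<comment> \<open>With p = |f(w)| and h at least |f|^2 / \<eta>^2, the inequality 2 p / \<eta>
      \<le> 1 + (p / \<eta>)^2 gives p / (1 + h(w)) \<le> \<eta> / 2.\<close>
    define m where "m = 1 / \<eta>\<^sup>2"
    define g where "g = m *\<^sub>R (f' * f)"
    have gw: "apply_bcontfun g w = of_real (m * (norm (apply_bcontfun f w))\<^sup>2)" for w
      by (simp add: g_def f' conjugate_def scaleR_field)
    have g: "g \<in> ?P"
    proof (rule nonneg_coneI[where t = "\<lambda>w. m * (norm (apply_bcontfun f w))\<^sup>2"])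
      show "g \<in> A" unfolding g_def by (intro subalgebra_scaleR subalgebra_mult sub f f')
    qed (use gw in \<open>auto simp: m_def\<close>)
    have "dist (u h * f) f < \<eta>" if h: "h \<in> ?P" "leq g h" for h
    proof -
      obtain t where t: "\<And>w. 0 \<le> t w" "\<And>w. apply_bcontfun h w = of_real (t w)"
        using nonneg_coneD[OF h(1)] by metis
      obtain s where s: "\<And>w. 0 \<le> s w" "\<And>w. apply_bcontfun (h - g) w = of_real (s w)"
        using h(2) nonneg_coneD unfolding leq_def by metis
      have "norm (apply_bcontfun (u h * f - f) w) \<le> \<eta> / 2" for w
      proof -
        define p where "p = norm (apply_bcontfun f w)"
        have "(of_real (t w) :: 'f) = of_real (m * p\<^sup>2 + s w)"
          using s(2)[of w] by (simp add: t gw p_def diff_eq_eq)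
        then have "t w = m * p\<^sup>2 + s w" by (simp only: of_real_eq_iff)
        then have tw: "m * p\<^sup>2 \<le> t w" using s(1)[of w] by simp
        have nz: "1 + t w > 0" using t(1)[of w] by linarith
        have uh: "apply_bcontfun (u h) w = of_real (t w / (1 + t w))"
          using u(3)[OF h(1), of w] t by simp
        have "apply_bcontfun (u h * f - f) w = (apply_bcontfun (u h) w - 1) * apply_bcontfun f w"
          by (simp add: algebra_simps)
        also have "apply_bcontfun (u h) w - 1 = of_real (t w / (1 + t w) - 1)"
          unfolding uh by simp
        also have "t w / (1 + t w) - 1 = - (1 / (1 + t w))"
          using nz by (simp add: field_simps)
        finally have "norm (apply_bcontfun (u h * f - f) w) = p / (1 + t w)"
          using nz by (simp add: norm_mult norm_divide p_def del: of_real_minus of_real_divide of_real_add)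
        also have "\<dots> \<le> \<eta> / 2"
        proof -
          have "0 \<le> (p / \<eta> - 1)\<^sup>2" by simp
          then have "2 * (p / \<eta>) \<le> 1 + m * p\<^sup>2"
            by (simp add: power2_eq_square m_def algebra_simps)
          then have "2 * p \<le> \<eta> * (1 + t w)"
            using \<eta> tw by (simp add: field_simps) (smt (verit) mult_left_mono)
          then show ?thesis using nz by (simp add: field_simps)
        qed
        finally show ?thesis .
      qed
      then have "norm (u h * f - f) \<le> \<eta> / 2" by (rule norm_bound)
      then show ?thesis using \<eta> by (simp add: dist_norm)
    qed
    then show "\<forall>\<^sub>F h in net_filter ?P leq. dist (u h * f) f < \<eta>"
      unfolding eventually_net_filter[OF dir] using g by blast
  qed
  then have "positive_left_approximate_identity A ?P 1 ?P leq u"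
    unfolding positive_left_approximate_identity_def left_approximate_identity_def
    using dir u by (auto simp: nonneg_cone_def)
  then show ?thesis by blast
qed

section \<open>The essential representation of the normalizer\<close>

text \<open>The constant \<open>K\<close> takes the place of the continuity clause in all estimates;
  it may be enlarged freely, and \<open>K \<ge> 1\<close> permits division by it. The locale serves
  both \<open>A\<close> on the whole space and the normalizer on the essential subspace.\<close>

locale bounded_representation =
  fixes A :: "('w discrete \<Rightarrow>\<^sub>C 'f::{real_normed_field,banach}) set"
    and scX :: "'f \<Rightarrow> 'x::banach \<Rightarrow> 'x" and Y :: "'x set"
    and \<sigma> :: "('w discrete \<Rightarrow>\<^sub>C 'f) \<Rightarrow> 'x \<Rightarrow> 'x" and K :: real
  assumes subalgebra: "subalgebra_over scale_fun A"
    and space: "normed_space_over scX"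
    and rep: "continuous_representation scale_fun A scX Y \<sigma>"
    and bound: "a \<in> A \<Longrightarrow> y \<in> Y \<Longrightarrow> norm (\<sigma> a y) \<le> K * norm a * norm y"
    and K_ge_1: "1 \<le> K"
begin

lemma module_scX: "module scX"
  using space by (rule normed_space_over_module)

lemma subspace_Y: "module.subspace scX Y"
  using rep by (simp add: continuous_representation_def)

lemma diff_in_Y: "y \<in> Y \<Longrightarrow> z \<in> Y \<Longrightarrow> y - z \<in> Y"
  by (rule module.subspace_diff[OF module_scX subspace_Y])

lemma closed_Y: "closed Y"
  using rep by (simp add: continuous_representation_def complete_eq_closed)

lemma
  assumes "a \<in> A"
  shows maps_to: "y \<in> Y \<Longrightarrow> \<sigma> a y \<in> Y"
    and add_right: "y \<in> Y \<Longrightarrow> z \<in> Y \<Longrightarrow> \<sigma> a (y + z) = \<sigma> a y + \<sigma> a z"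
    and scale_right: "y \<in> Y \<Longrightarrow> \<sigma> a (scX c y) = scX c (\<sigma> a y)"
    and add_left: "b \<in> A \<Longrightarrow> y \<in> Y \<Longrightarrow> \<sigma> (a + b) y = \<sigma> a y + \<sigma> b y"
    and scale_left: "y \<in> Y \<Longrightarrow> \<sigma> (scale_fun c a) y = scX c (\<sigma> a y)"
    and mult: "b \<in> A \<Longrightarrow> y \<in> Y \<Longrightarrow> \<sigma> (a * b) y = \<sigma> a (\<sigma> b y)"
  using rep assms unfolding continuous_representation_def by auto

lemma diff_right: "a \<in> A \<Longrightarrow> y \<in> Y \<Longrightarrow> z \<in> Y \<Longrightarrow> \<sigma> a (y - z) = \<sigma> a y - \<sigma> a z"
  using add_right[of a "y - z" z] diff_in_Y[of y z] by (simp add: eq_diff_eq)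

lemma diff_left: "a \<in> A \<Longrightarrow> b \<in> A \<Longrightarrow> y \<in> Y \<Longrightarrow> \<sigma> (a - b) y = \<sigma> a y - \<sigma> b y"
  using add_left[of "a - b" b y] subalgebra_diff[OF subalgebra, of a b] by (simp add: eq_diff_eq)

lemma tendsto_left:
  assumes "(f \<longlongrightarrow> a) F" and "\<forall>\<^sub>F i in F. f i \<in> A" and "a \<in> A" and "y \<in> Y"
  shows "((\<lambda>i. \<sigma> (f i) y) \<longlongrightarrow> \<sigma> a y) F"
proof (rule Lim_transform_bound[where g = "\<lambda>i. K * norm (f i - a) * norm y", THEN Lim_null[THEN iffD2]])
  show "\<forall>\<^sub>F i in F. norm (\<sigma> (f i) y - \<sigma> a y) \<le> norm (K * norm (f i - a) * norm y)"
    using assms(2)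
  proof eventually_elim
    case (elim i)
    then show ?case
      using bound[of "f i - a" y] diff_left[of "f i" a y] subalgebra_diff[OF subalgebra, of "f i" a] assms K_ge_1
      by (simp add: abs_mult)
  qed
  show "((\<lambda>i. K * norm (f i - a) * norm y) \<longlongrightarrow> 0) F"
    using assms(1) by (auto intro!: tendsto_eq_intros simp: Lim_null[of f])
qed

lemma continuous_on_right:
  assumes "a \<in> A"
  shows "continuous_on Y (\<sigma> a)"
proof (rule continuous_on_subset[OF lipschitz_on_continuous_on])
  show "(K * norm a)-lipschitz_on Y (\<sigma> a)"
  proof (rule lipschitz_onI)
    show "dist (\<sigma> a y) (\<sigma> a z) \<le> K * norm a * dist y z" if "y \<in> Y" "z \<in> Y" for y z
      using bound[OF assms, of "y - z"] diff_right[OF assms, of y z] diff_in_Y that by (simp add: dist_norm)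
    show "0 \<le> K * norm a" using K_ge_1 by simp
  qed
qed auto

end

lemma bounded_representation_exists:
  fixes A :: "('w discrete \<Rightarrow>\<^sub>C 'f::{real_normed_field,banach}) set"
    and scX :: "'f \<Rightarrow> 'x::banach \<Rightarrow> 'x"
  assumes sub: "subalgebra_over scale_fun A" and sp: "normed_space_over scX"
    and rep: "continuous_representation scale_fun A scX Y \<sigma>"
  obtains K where "bounded_representation A scX Y \<sigma> K"
proof -
  have 0: "0 \<in> A" by (rule subalgebra_zero[OF sub])
  have \<sigma>0: "\<sigma> 0 y = 0" if "y \<in> Y" for y
  proof -
    have "\<sigma> (0 + 0) y = \<sigma> 0 y + \<sigma> 0 y"
      using rep that 0 unfolding continuous_representation_def by blast
    then show ?thesis by simp
  qed
  have "\<exists>\<zeta>>0. \<forall>b\<in>A. norm (b - 0) < \<zeta> \<longrightarrow> (\<forall>y\<in>Y. norm (\<sigma> b y - \<sigma> 0 y) \<le> 1 * norm y)"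
    using rep 0 zero_less_one unfolding continuous_representation_def by blast
  then obtain \<zeta> where \<zeta>: "\<zeta> > 0"
      "\<And>b y. b \<in> A \<Longrightarrow> norm b < \<zeta> \<Longrightarrow> y \<in> Y \<Longrightarrow> norm (\<sigma> b y) \<le> norm y"
    using \<sigma>0 by auto
  show ?thesis
  proof (rule that[of "max 1 (2 / \<zeta>)"], standard)
    fix a y assume ay: "a \<in> A" "y \<in> Y"
    \<comment> \<open>Rescales a to norm \<zeta> / 2, inside the ball on which continuity at 0
      bounds the operators by 1. The case a = 0, where the quotient is 0, is treated
      separately.\<close>
    define t where "t = \<zeta> / (2 * norm a)"
    have "norm (\<sigma> a y) \<le> 2 / \<zeta> * norm a * norm y"
    proof (cases "a = 0")
      case False
      then have t: "t > 0" "norm (t *\<^sub>R a) < \<zeta>" using \<zeta> by (auto simp: t_def)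
      have "\<sigma> (t *\<^sub>R a) y = scX (of_real t) (\<sigma> a y)"
        using rep ay unfolding continuous_representation_def by (metis scale_fun_of_real)
      then have "\<sigma> (t *\<^sub>R a) y = t *\<^sub>R \<sigma> a y"
        using sp by (simp add: normed_space_over_def)
      then have "t * norm (\<sigma> a y) \<le> norm y"
        using \<zeta>(2)[of "t *\<^sub>R a" y] ay t subalgebra_scaleR[OF sub] by simp
      then show ?thesis
        using False \<zeta>(1) by (simp add: t_def field_simps)
    qed (use \<sigma>0 ay in simp)
    also have "\<dots> \<le> max 1 (2 / \<zeta>) * norm a * norm y"
      by (intro mult_right_mono) auto
    finally show "norm (\<sigma> a y) \<le> max 1 (2 / \<zeta>) * norm a * norm y" .
  qed (use assms in auto)
qed

section \<open>Limits along nets and closures of subspaces\<close>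

lemma net_filter_neq_bot:
  assumes "directed_set L le"
  shows "net_filter L le \<noteq> bot"
  unfolding trivial_limit_def eventually_net_filter[OF assms]
  using assms by (auto simp: directed_set_def reflp_on_def)

lemma eventually_in_net:
  assumes "directed_set L le"
  shows "\<forall>\<^sub>F i in net_filter L le. i \<in> L"
  unfolding eventually_net_filter[OF assms] using assms by (auto simp: directed_set_def)

text \<open>The centre y may depend on \<eta>, so no limit has to be guessed: in
  \<open>ext_tendsto\<close> the centres are values of the net itself.\<close>

lemma convergent_filter_if_Cauchy:
  fixes f :: "'i \<Rightarrow> 'x::complete_space"
  assumes "F \<noteq> bot" and "\<And>\<eta>. \<eta> > 0 \<Longrightarrow> \<exists>y. \<forall>\<^sub>F i in F. dist (f i) y < \<eta>"
  shows "\<exists>l. (f \<longlongrightarrow> l) F"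
proof -
  have "cauchy_filter (filtermap f F)"
    unfolding cauchy_filter_metric_filtermap
  proof (intro allI impI)
    fix \<eta> :: real assume "\<eta> > 0"
    then obtain y where "\<forall>\<^sub>F i in F. dist (f i) y < \<eta> / 2"
      using assms(2)[of "\<eta> / 2"] by auto
    then show "\<exists>P. eventually P F \<and> (\<forall>i j. P i \<and> P j \<longrightarrow> dist (f i) (f j) < \<eta>)"
      by (intro exI[of _ "\<lambda>i. dist (f i) y < \<eta> / 2"]) (auto intro: dist_triangle_half_l)
  qed
  then have "\<exists>l\<in>UNIV. filtermap f F \<le> nhds l"
    using assms(1) complete_UNIV[where 'a = 'x] unfolding complete_uniform by (auto simp: filtermap_bot_iff)
  then show ?thesis
    by (simp add: filterlim_def)
qed

lemma bounded_linear_scX: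
  fixes scX :: "'f::real_normed_field \<Rightarrow> 'x::real_normed_vector \<Rightarrow> 'x"
  assumes "normed_space_over scX"
  shows "bounded_linear (scX c)"
proof (rule bounded_linear_intro[where K = "norm c"])
  interpret X: module scX
    by (rule normed_space_over_module[OF assms])
  have r: "scX (of_real t) x = t *\<^sub>R x" for t x
    using assms by (simp add: normed_space_over_def)
  show "scX c (t *\<^sub>R x) = t *\<^sub>R scX c x" for t x
    by (metis X.scale_left_commute r)
qed (use assms in \<open>auto simp: normed_space_over_def vector_space.vector_space_assms mult.commute\<close>)

lemma subspace_closure:
  assumes "normed_space_over scX" and "module.subspace scX V"
  shows "module.subspace scX (closure V)"
proof -
  note m = normed_space_over_module[OF assms(1)]
  have V: "0 \<in> V" "\<And>x y. x \<in> V \<Longrightarrow> y \<in> V \<Longrightarrow> x + y \<in> V" "\<And>c x. x \<in> V \<Longrightarrow> scX c x \<in> V"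
    using assms(2) unfolding module.subspace_def[OF m] by auto
  show ?thesis
    unfolding module.subspace_def[OF m]
  proof (intro conjI ballI allI)
    show "0 \<in> closure V" using V(1) closure_subset by blast
    show "x + y \<in> closure V" if xy: "x \<in> closure V" "y \<in> closure V" for x y
    proof -
      obtain f g where "\<And>n. f n \<in> V" "f \<longlonglongrightarrow> x" "\<And>n. g n \<in> V" "g \<longlonglongrightarrow> y"
        using xy unfolding closure_sequential by metis
      then show ?thesis
        unfolding closure_sequential by (intro exI[of _ "\<lambda>n. f n + g n"]) (simp add: V tendsto_add)
    qed
    show "scX c x \<in> closure V" if x: "x \<in> closure V" for c x
    proof -
      obtain f where "\<And>n. f n \<in> V" "f \<longlonglongrightarrow> x"
        using x unfolding closure_sequential by metis
      then show ?thesis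
        unfolding closure_sequential
        by (intro exI[of _ "\<lambda>n. scX c (f n)"])
           (simp add: V bounded_linear.tendsto[OF bounded_linear_scX[OF assms(1)]])
    qed
  qed
qed

locale essential_representation = bounded_representation A scX UNIV \<pi> K
  for A :: "('w discrete \<Rightarrow>\<^sub>C 'f::{real_normed_field,banach}) set"
    and scX :: "'f \<Rightarrow> 'x::banach \<Rightarrow> 'x" and \<pi> K +
  fixes L :: "'l set" and le and e
  assumes approximate_identity: "left_approximate_identity A 1 L le e"
begin

abbreviation "F \<equiv> net_filter L le"
abbreviation "Xe \<equiv> essential_subspace A scX \<pi>"

lemma directed: "directed_set L le"
  and e_in: "i \<in> L \<Longrightarrow> e i \<in> A"
  and norm_e: "i \<in> L \<Longrightarrow> norm (e i) \<le> 1"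
  and e_tendsto: "a \<in> A \<Longrightarrow> ((\<lambda>i. e i * a) \<longlongrightarrow> a) F"
  using approximate_identity by (auto simp: left_approximate_identity_def)

lemmas F_neq_bot = net_filter_neq_bot[OF directed]
lemmas eventually_L = eventually_in_net[OF directed]

text \<open>The bound is free of i since \<open>e i\<close> has norm at most 1. This uniformity
  carries convergence from a dense set to its closure and makes the limit operators bounded.\<close>

lemma e_bound: "i \<in> L \<Longrightarrow> b * e i \<in> A \<Longrightarrow> norm (\<pi> (b * e i) y) \<le> K * norm b * norm y"
proof -
  assume i: "i \<in> L" and be: "b * e i \<in> A"
  have "norm (b * e i) \<le> norm b * norm (e i)"
    by (rule norm_mult_ineq)
  also have "\<dots> \<le> norm b"
    using norm_e[OF i] by (simp add: mult_left_le)
  finally have "K * norm (b * e i) * norm y \<le> K * norm b * norm y"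
    using K_ge_1 by (intro mult_right_mono mult_left_mono) auto
  then show ?thesis
    using bound[OF be, of y] by auto
qed

lemma subspace_Xe: "module.subspace scX Xe"
  unfolding essential_subspace_def
  by (intro subspace_closure space module.subspace_span module_scX)

lemma closed_Xe: "closed Xe"
  by (simp add: essential_subspace_def)

lemma in_Xe: "a \<in> A \<Longrightarrow> \<pi> a x \<in> Xe"
  unfolding essential_subspace_def
  by (rule subsetD[OF closure_subset]) (auto intro: module.span_base[OF module_scX])

text \<open>The vectors with this property form a subspace containing every
  \<open>\<pi> a x\<close>, since \<open>e i * a\<close> tends to \<open>a\<close>; the uniform
  bound extends the property to the closure.\<close>

lemma tendsto_e:
  assumes "y \<in> Xe"
  shows "((\<lambda>i. \<pi> (e i) y) \<longlongrightarrow> y) F"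
proof -
  let ?W = "{y. ((\<lambda>i. \<pi> (e i) y) \<longlongrightarrow> y) F}"
  have "module.subspace scX ?W"
    unfolding module.subspace_def[OF module_scX]
  proof (intro conjI ballI allI CollectI; (elim CollectE)?)
    have "\<forall>\<^sub>F i in F. \<pi> (e i) 0 = 0"
      using eventually_L by eventually_elim (use diff_right[OF e_in, of _ 0 0] in auto)
    then show "((\<lambda>i. \<pi> (e i) 0) \<longlongrightarrow> 0) F"
      by (rule tendsto_eventually)
  next
    fix y z assume "((\<lambda>i. \<pi> (e i) y) \<longlongrightarrow> y) F" "((\<lambda>i. \<pi> (e i) z) \<longlongrightarrow> z) F"
    then have "((\<lambda>i. \<pi> (e i) y + \<pi> (e i) z) \<longlongrightarrow> y + z) F"
      by (rule tendsto_add)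
    moreover have "\<forall>\<^sub>F i in F. \<pi> (e i) y + \<pi> (e i) z = \<pi> (e i) (y + z)"
      using eventually_L by eventually_elim (simp add: add_right e_in)
    ultimately show "((\<lambda>i. \<pi> (e i) (y + z)) \<longlongrightarrow> y + z) F"
      by (rule Lim_transform_eventually)
  next
    fix c y assume "((\<lambda>i. \<pi> (e i) y) \<longlongrightarrow> y) F"
    then have "((\<lambda>i. scX c (\<pi> (e i) y)) \<longlongrightarrow> scX c y) F"
      by (rule bounded_linear.tendsto[OF bounded_linear_scX[OF space]])
    moreover have "\<forall>\<^sub>F i in F. scX c (\<pi> (e i) y) = \<pi> (e i) (scX c y)"
      using eventually_L by eventually_elim (simp add: scale_right e_in)
    ultimately show "((\<lambda>i. \<pi> (e i) (scX c y)) \<longlongrightarrow> scX c y) F"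
      by (rule Lim_transform_eventually)
  qed
  moreover have "\<pi> a x \<in> ?W" if "a \<in> A" for a x
  proof -
    have "((\<lambda>i. \<pi> (e i * a) x) \<longlongrightarrow> \<pi> a x) F"
      using eventually_L that
      by (intro tendsto_left e_tendsto) (auto elim!: eventually_mono intro: subalgebra_mult[OF subalgebra] e_in)
    moreover have "\<forall>\<^sub>F i in F. \<pi> (e i * a) x = \<pi> (e i) (\<pi> a x)"
      using eventually_L by eventually_elim (simp add: mult e_in that)
    ultimately show ?thesis
      by (simp add: Lim_transform_eventually)
  qed
  ultimately have span: "module.span scX {\<pi> a x |a x. a \<in> A} \<subseteq> ?W"
    by (intro module.span_minimal[OF module_scX]) auto
  show ?thesis
  proof (rule tendstoI)
    fix \<eta> :: real assume \<eta>: "0 < \<eta>"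
    \<comment> \<open>Exchanging y for z costs \<open>K * \<zeta>\<close> under
      \<open>\<pi> (e i)\<close> and \<zeta> for y itself, together \<eta> / 2.\<close>
    define \<zeta> where "\<zeta> = \<eta> / (2 * (K + 1))"
    have \<zeta>: "\<zeta> > 0" "(K + 1) * \<zeta> = \<eta> / 2" using \<eta> K_ge_1 by (auto simp: \<zeta>_def field_simps)
    obtain z where z: "z \<in> module.span scX {\<pi> a x |a x. a \<in> A}" "dist z y < \<zeta>"
      using assms \<zeta>(1) unfolding essential_subspace_def closure_approachable by blast
    have "\<forall>\<^sub>F i in F. dist (\<pi> (e i) z) z < \<eta> / 2"
      using z(1) span \<eta> by (intro tendstoD) auto
    with eventually_L show "\<forall>\<^sub>F i in F. dist (\<pi> (e i) y) y < \<eta>"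
    proof eventually_elim
      case (elim i)
      have "norm (\<pi> (e i) (y - z)) \<le> K * norm (y - z)"
        using e_bound[of i 1 "y - z"] elim e_in by simp
      moreover have "\<pi> (e i) (y - z) = \<pi> (e i) y - \<pi> (e i) z"
        using elim by (simp add: diff_right e_in)
      moreover have "K * norm (y - z) + norm (y - z) \<le> \<eta> / 2"
        using z(2) K_ge_1 unfolding \<zeta>(2)[symmetric] dist_norm
        by (simp add: algebra_simps norm_minus_commute add_mono mult_left_mono)
      moreover have "\<pi> (e i) y - y = (\<pi> (e i) y - \<pi> (e i) z) + (\<pi> (e i) z - z) + (z - y)"
        by simp
      then have "norm (\<pi> (e i) y - y) \<le> norm (\<pi> (e i) y - \<pi> (e i) z) + norm (\<pi> (e i) z - z) + norm (z - y)"
        by (metis norm_triangle_le norm_triangle_ineq add_mono order_refl)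
      ultimately show ?case
        using elim by (simp add: dist_norm norm_minus_commute)
    qed
  qed
qed

text \<open>The formula is forced: under any multiplicative extension by bounded operators, b
  applied to y is the limit of b applied to \<open>\<pi> (e i) y\<close>, which is
  \<open>\<pi> (b * e i) y\<close>.\<close>

definition ext where "ext b y = Lim F (\<lambda>i. \<pi> (b * e i) y)"

lemma mult_e_in: "b \<in> normalizer A \<Longrightarrow> i \<in> L \<Longrightarrow> b * e i \<in> A"
  by (simp add: normalizer_def e_in)

text \<open>With \<open>\<pi> (e j) y\<close> in place of y convergence is clear, since
  \<open>b * e i * e j\<close> tends to \<open>b * e j\<close> along i. The uniform bound keeps the
  net for y close to that one when \<open>\<pi> (e j) y\<close> is close to y.\<close>

lemma ext_tendsto:
  assumes b: "b \<in> normalizer A" and y: "y \<in> Xe"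
  shows "((\<lambda>i. \<pi> (b * e i) y) \<longlongrightarrow> ext b y) F"
proof -
  have "\<exists>l. ((\<lambda>i. \<pi> (b * e i) y) \<longlongrightarrow> l) F"
  proof (rule convergent_filter_if_Cauchy[OF F_neq_bot])
    fix \<eta> :: real assume \<eta>: "\<eta> > 0"
    \<comment> \<open>The added 1 keeps p positive when b = 0.\<close>
    define p where "p = K * norm b + 1"
    have Kb: "0 \<le> K * norm b" using K_ge_1 by simp
    then have p: "p > 0" by (simp add: p_def)
    define \<zeta> where "\<zeta> = \<eta> / 2 / p"
    have \<zeta>: "\<zeta> > 0" "p * \<zeta> = \<eta> / 2"
      using \<eta> p by (auto simp: \<zeta>_def)
    have "\<forall>\<^sub>F j in F. dist (\<pi> (e j) y) y < \<zeta> \<and> j \<in> L"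
      using tendstoD[OF tendsto_e[OF y] \<zeta>(1)] eventually_L by (rule eventually_conj)
    then obtain j where j: "dist (\<pi> (e j) y) y < \<zeta>" "j \<in> L"
      using F_neq_bot eventually_happens' by blast
    have "((\<lambda>i. b * (e i * e j)) \<longlongrightarrow> b * e j) F"
      by (intro tendsto_mult tendsto_const e_tendsto e_in j)
    then have "((\<lambda>i. \<pi> (b * (e i * e j)) y) \<longlongrightarrow> \<pi> (b * e j) y) F"
      using eventually_L j mult_e_in[OF b]
      by (intro tendsto_left) (auto elim!: eventually_mono intro: subalgebra_mult[OF subalgebra] e_in simp: mult.assoc[symmetric])
    then have "\<forall>\<^sub>F i in F. dist (\<pi> (b * (e i * e j)) y) (\<pi> (b * e j) y) < \<eta> / 2"
      using \<eta> by (intro tendstoD) auto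
    with eventually_L have "\<forall>\<^sub>F i in F. dist (\<pi> (b * e i) y) (\<pi> (b * e j) y) < \<eta>"
    proof eventually_elim
      case (elim i)
      have "norm (\<pi> (b * e i) (y - \<pi> (e j) y)) \<le> K * norm b * norm (y - \<pi> (e j) y)"
        using e_bound mult_e_in[OF b] elim by blast
      also have "\<dots> \<le> K * norm b * \<zeta>"
        using Kb j by (intro mult_left_mono) (auto simp: dist_norm norm_minus_commute)
      also have "\<dots> \<le> \<eta> / 2"
        using \<zeta> by (simp add: p_def distrib_right)
      finally have "dist (\<pi> (b * e i) y) (\<pi> (b * (e i * e j)) y) \<le> \<eta> / 2"
        using elim mult_e_in[OF b] j by (simp add: dist_norm diff_right mult[symmetric] e_in mult.assoc)
      then show ?case
        using elim dist_triangle[of "\<pi> (b * e i) y" "\<pi> (b * e j) y" "\<pi> (b * (e i * e j)) y"] by linarith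
    qed
    then show "\<exists>z. \<forall>\<^sub>F i in F. dist (\<pi> (b * e i) y) z < \<eta>" by blast
  qed
  then show ?thesis
    unfolding ext_def using tendsto_Lim[OF F_neq_bot] by auto
qed

lemma ext_eqI:
  assumes "b \<in> normalizer A" "y \<in> Xe" "(f \<longlongrightarrow> l) F" and "\<And>i. i \<in> L \<Longrightarrow> f i = \<pi> (b * e i) y"
  shows "ext b y = l"
proof -
  have "\<forall>\<^sub>F i in F. f i = \<pi> (b * e i) y"
    using eventually_L by eventually_elim (rule assms)
  with assms(3) have "((\<lambda>i. \<pi> (b * e i) y) \<longlongrightarrow> l) F"
    by (rule Lim_transform_eventually)
  then show ?thesis
    using tendsto_unique[OF F_neq_bot ext_tendsto[OF assms(1,2)]] by simp
qed

lemma ext_eq: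
  assumes "a \<in> A" "y \<in> Xe"
  shows "ext a y = \<pi> a y"
proof (rule ext_eqI)
  show "a \<in> normalizer A" using subset_normalizer[OF subalgebra] assms by blast
  \<comment> \<open>Commutativity turns \<open>a * e i\<close> into \<open>e i * a\<close>, to which
    the left approximate identity applies.\<close>
  show "((\<lambda>i. \<pi> (e i * a) y) \<longlongrightarrow> \<pi> a y) F"
    using eventually_L assms
    by (intro tendsto_left e_tendsto) (auto elim!: eventually_mono intro: subalgebra_mult[OF subalgebra] e_in)
qed (auto simp: mult.commute assms)

lemma ext_one: "y \<in> Xe \<Longrightarrow> ext 1 y = y"
  by (rule ext_eqI[OF one_in_normalizer _ tendsto_e]) auto

lemma ext_in_Xe: "b \<in> normalizer A \<Longrightarrow> y \<in> Xe \<Longrightarrow> ext b y \<in> Xe"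
  using eventually_L F_neq_bot
  by (intro Lim_in_closed_set[OF closed_Xe _ _ ext_tendsto])
     (auto elim!: eventually_mono intro: in_Xe mult_e_in)

lemma ext_bound:
  assumes "b \<in> normalizer A" "y \<in> Xe"
  shows "norm (ext b y) \<le> K * norm b * norm y"
proof (rule tendsto_upperbound[OF tendsto_norm[OF ext_tendsto[OF assms]] _ F_neq_bot])
  show "\<forall>\<^sub>F i in F. norm (\<pi> (b * e i) y) \<le> K * norm b * norm y"
    using eventually_L by eventually_elim (intro e_bound mult_e_in assms)
qed

text \<open>Each \<open>b * e i\<close> is a nonnegative function in \<open>A\<close>, so positivity
  of \<pi> applies before the limit and closedness of \<open>XP\<close> in the limit.\<close>

lemma ext_positive:
  assumes "closed XP" "positive_representation (nonneg_cone A) XP \<pi>" "\<And>i. i \<in> L \<Longrightarrow> e i \<in> nonneg_cone A"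
  shows "positive_representation (nonneg_cone (normalizer A)) (Xe \<inter> XP) ext"
  unfolding positive_representation_def
proof (intro ballI IntI)
  fix b y assume b: "b \<in> nonneg_cone (normalizer A)" and y: "y \<in> Xe \<inter> XP"
  then have b': "b \<in> normalizer A" by (simp add: nonneg_cone_def)
  show "ext b y \<in> Xe" using b' y by (simp add: ext_in_Xe)
  show "ext b y \<in> XP"
  proof (rule Lim_in_closed_set[OF assms(1) _ F_neq_bot ext_tendsto[OF b']])
    show "\<forall>\<^sub>F i in F. \<pi> (b * e i) y \<in> XP"
      using eventually_L
    proof eventually_elim
      case (elim i)
      then have "b * e i \<in> nonneg_cone A"
        by (intro nonneg_cone_mult[OF b assms(3)] mult_e_in b')
      then show ?case
        using y assms(2) by (simp add: positive_representation_def)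
    qed
  qed (use y in auto)
qed

lemma ext_diff_left:
  assumes "a \<in> normalizer A" "b \<in> normalizer A" "y \<in> Xe"
  shows "ext (a - b) y = ext a y - ext b y"
proof (rule ext_eqI[OF _ _ tendsto_diff[OF ext_tendsto[OF assms(1,3)] ext_tendsto[OF assms(2,3)]]])
  show "a - b \<in> normalizer A"
    by (intro subalgebra_diff subalgebra_normalizer subalgebra assms)
qed (use assms in \<open>simp_all add: left_diff_distrib diff_left mult_e_in\<close>)

lemma continuous_representation_ext:
  "continuous_representation scale_fun (normalizer A) scX Xe ext"
  unfolding continuous_representation_def
proof (intro conjI ballI allI impI)
  note subB = subalgebra_normalizer[OF subalgebra]
  note subX = subspace_Xe[unfolded module.subspace_def[OF module_scX]]
  show "complete Xe" using closed_Xe by (simp add: complete_eq_closed)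
  show "\<exists>C. \<forall>y\<in>Xe. norm (ext b y) \<le> C * norm y" if "b \<in> normalizer A" for b
    using ext_bound that by blast
  show "ext b (y + z) = ext b y + ext b z" if "b \<in> normalizer A" "y \<in> Xe" "z \<in> Xe" for b y z
    using that subX by (intro ext_eqI[OF _ _ tendsto_add[OF ext_tendsto ext_tendsto]]) (auto simp: add_right mult_e_in)
  show "ext b (scX c y) = scX c (ext b y)" if "b \<in> normalizer A" "y \<in> Xe" for b c y
    using that subX
    by (intro ext_eqI[OF _ _ bounded_linear.tendsto[OF bounded_linear_scX[OF space] ext_tendsto]])
       (auto simp: scale_right mult_e_in)
  show "ext (a + b) y = ext a y + ext b y" if "a \<in> normalizer A" "b \<in> normalizer A" "y \<in> Xe" for a b y
    using that subalgebra_add[OF subB]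
    by (intro ext_eqI[OF _ _ tendsto_add[OF ext_tendsto ext_tendsto]]) (auto simp: distrib_right add_left mult_e_in)
  show "ext (scale_fun c b) y = scX c (ext b y)" if "b \<in> normalizer A" "y \<in> Xe" for b c y
    using that subB
    by (intro ext_eqI[OF _ _ bounded_linear.tendsto[OF bounded_linear_scX[OF space] ext_tendsto]])
       (auto simp: scale_left scale_fun_mult mult_e_in subalgebra_over_scale_fun)
  show "ext (a * b) y = ext a (ext b y)" if ab: "a \<in> normalizer A" "b \<in> normalizer A" and y: "y \<in> Xe" for a b y
  proof -
    \<comment> \<open>One factor \<open>e j\<close> is kept so that all operators come from
      \<open>A\<close>: the limit over i is taken first, by continuity of two fixed operators, and
      the limit over j afterwards.\<close>
    have "\<pi> (a * e j) (ext b y) = \<pi> (a * b * e j) y" if j: "j \<in> L" for j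
    proof -
      have ajA: "a * e j \<in> A" and abjA: "a * b * e j \<in> A"
        using ab j by (auto intro: mult_e_in subalgebra_mult[OF subB])
      have 1: "((\<lambda>i. \<pi> (a * e j) (\<pi> (b * e i) y)) \<longlongrightarrow> \<pi> (a * e j) (ext b y)) F"
        using continuous_on_tendsto_compose[OF continuous_on_right[OF ajA] ext_tendsto[OF ab(2) y]] by simp
      have 2: "((\<lambda>i. \<pi> (a * b * e j) (\<pi> (e i) y)) \<longlongrightarrow> \<pi> (a * b * e j) y) F"
        using continuous_on_tendsto_compose[OF continuous_on_right[OF abjA] tendsto_e[OF y]] by simp
      have "\<forall>\<^sub>F i in F. \<pi> (a * b * e j) (\<pi> (e i) y) = \<pi> (a * e j) (\<pi> (b * e i) y)"
        using eventually_L
      proof eventually_elim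
        case (elim i)
        have "a * b * e j * e i = a * e j * (b * e i)" by (simp add: ac_simps)
        then show ?case
          using mult[OF abjA e_in[OF elim], of y] mult[OF ajA mult_e_in[OF ab(2) elim], of y] by (metis UNIV_I)
      qed
      then show ?thesis
        by (rule tendsto_unique[OF F_neq_bot 1 Lim_transform_eventually[OF 2]])
    qed
    then show ?thesis
      using ab y by (intro ext_eqI[OF _ _ ext_tendsto]) (auto intro: ext_in_Xe subalgebra_mult[OF subB])
  qed
  fix a and \<eta> :: real assume a: "a \<in> normalizer A" and \<eta>: "0 < \<eta>"
  show "\<exists>\<zeta>>0. \<forall>b\<in>normalizer A. norm (b - a) < \<zeta> \<longrightarrow> (\<forall>y\<in>Xe. norm (ext b y - ext a y) \<le> \<eta> * norm y)"
  proof (intro exI[of _ "\<eta> / K"] conjI ballI impI)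
    show "0 < \<eta> / K" using \<eta> K_ge_1 by simp
    fix b y assume b: "b \<in> normalizer A" and ba: "norm (b - a) < \<eta> / K" and y: "y \<in> Xe"
    have "norm (ext b y - ext a y) \<le> K * norm (b - a) * norm y"
      using ext_bound[of "b - a" y] ext_diff_left[OF b a y] subalgebra_diff[OF subB b a] y by simp
    also have "\<dots> \<le> \<eta> * norm y"
      using ba K_ge_1 by (intro mult_right_mono) (auto simp: field_simps)
    finally show "norm (ext b y - ext a y) \<le> \<eta> * norm y" .
  qed
qed (simp_all add: ext_in_Xe subspace_Xe)

end

section \<open>Limits of inverse powers\<close>

lemma geometric_Cauchy_limit:
  fixes f :: "nat \<Rightarrow> 'x::banach"
  assumes "\<And>k. k \<ge> k0 \<Longrightarrow> norm (f (Suc k) - f k) \<le> D / 2 ^ Suc k"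
  shows "convergent f" and "k \<ge> k0 \<Longrightarrow> norm (lim f - f k) \<le> D / 2 ^ k"
proof -
  have D: "0 \<le> D"
    using order_trans[OF norm_ge_zero assms[OF order_refl]] by (auto simp: zero_le_divide_iff power_le_zero_eq)
  \<comment> \<open>The subtracted term is the part of the geometric series not yet used up; it lets
    the induction absorb the next step exactly.\<close>
  have *: "norm (f m - f k) \<le> D / 2 ^ k - D / 2 ^ m" if "k0 \<le> k" "k \<le> m" for k m
    using that(2)
  proof (induction m rule: dec_induct)
    case (step m)
    have "norm (f (Suc m) - f k) \<le> norm (f (Suc m) - f m) + norm (f m - f k)"
      using norm_triangle_ineq[of "f (Suc m) - f m" "f m - f k"] by simp
    also have "\<dots> \<le> D / 2 ^ Suc m + (D / 2 ^ k - D / 2 ^ m)"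
      using step assms[of m] that(1) by (intro add_mono) auto
    also have "\<dots> = D / 2 ^ k - D / 2 ^ Suc m" by simp
    finally show ?case .
  qed simp
  then have **: "norm (f m - f k) \<le> D / 2 ^ k" if "k0 \<le> k" "k \<le> m" for k m
    using that D by (smt (verit) divide_nonneg_pos zero_less_power)
  have lim0: "(\<lambda>k. D / 2 ^ k) \<longlonglongrightarrow> 0"
    using tendsto_mult[OF tendsto_const LIMSEQ_realpow_zero[of "1 / 2"], of D] by (simp add: power_divide)
  have "Cauchy f"
  proof (rule metric_CauchyI)
    fix \<eta> :: real assume "\<eta> > 0"
    then have "\<forall>\<^sub>F k in sequentially. D / 2 ^ k < \<eta> / 2 \<and> k \<ge> k0"
      using lim0 by (intro eventually_conj order_tendstoD(2) eventually_ge_at_top) auto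
    then obtain k where k: "D / 2 ^ k < \<eta> / 2" "k \<ge> k0"
      using eventually_happens'[OF sequentially_bot] by blast
    have "dist (f m) (f k) < \<eta> / 2" if "m \<ge> k" for m
      using **[of k m] k that unfolding dist_norm by linarith
    then show "\<exists>M. \<forall>m\<ge>M. \<forall>n\<ge>M. dist (f m) (f n) < \<eta>"
      by (metis dist_triangle_half_l)
  qed
  then show "convergent f"
    by (simp add: Cauchy_convergent_iff)
  then have "(\<lambda>m. norm (f m - f k)) \<longlonglongrightarrow> norm (lim f - f k)"
    by (intro tendsto_intros) (simp add: convergent_LIMSEQ_iff)
  then show "norm (lim f - f k) \<le> D / 2 ^ k" if "k \<ge> k0"
    by (rule LIMSEQ_le_const2) (use ** that in blast)
qed

lemma totally_bounded_image:
  fixes f :: "'a::metric_space \<Rightarrow> 'b::metric_space"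
  assumes "uniformly_continuous_on T f" and "totally_bounded T"
  shows "totally_bounded (f ` T)"
  unfolding totally_bounded_metric
proof (intro allI impI)
  fix \<eta> :: real assume "\<eta> > 0"
  then obtain d where d: "d > 0" "\<And>x y. x \<in> T \<Longrightarrow> y \<in> T \<Longrightarrow> dist x y < d \<Longrightarrow> dist (f x) (f y) < \<eta>"
    using assms(1) unfolding uniformly_continuous_on_def by metis
  obtain N where N: "finite N" "T \<subseteq> (\<Union>x\<in>N. {y. dist x y < d / 2})"
    using assms(2) d(1) unfolding totally_bounded_metric by (meson half_gt_zero)
  \<comment> \<open>Uniform continuity holds on \<open>T\<close> only, while the centres in
    \<open>N\<close> may lie outside. Each useful centre is moved to a point of \<open>T\<close>
    within d / 2, hence the radius d / 2 in the choice of \<open>N\<close>.\<close>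
  define p where "p = (\<lambda>x. SOME y. y \<in> T \<and> dist x y < d / 2)"
  show "\<exists>N'. finite N' \<and> f ` T \<subseteq> (\<Union>x\<in>N'. {y. dist x y < \<eta>})"
  proof (intro exI conjI subsetI)
    show "finite ((f \<circ> p) ` N)" using N by simp
    fix z assume "z \<in> f ` T"
    then obtain y where y: "y \<in> T" "z = f y" by blast
    then obtain x where x: "x \<in> N" "dist x y < d / 2" using N by blast
    then have px: "p x \<in> T \<and> dist x (p x) < d / 2"
      unfolding p_def by (intro someI[of "\<lambda>y. y \<in> T \<and> dist x y < d / 2" y]) (use y(1) in simp)
    then have "dist (p x) y < d"
      using x(2) dist_triangle3[of "p x" y x] by linarith
    then have "dist (f (p x)) z < \<eta>"
      using d(2) px y by blast
    then show "z \<in> (\<Union>x\<in>(f \<circ> p) ` N. {y. dist x y < \<eta>})"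
      using x(1) by auto
  qed
qed

text \<open>Here \<open>D n\<close> is the budget for the total movement of the n-th inverse powers
  from stage \<open>k0 n\<close> on. The factor in \<open>u_approx\<close> is \<open>K\<close> times
  the norm bound of the cofactor in \<open>c_power_diff\<close>, so step k spends at most
  \<open>D n / 2 ^ Suc k\<close>.\<close>

locale factorization_sequence = bounded_representation B scX Y \<sigma> K
  for B :: "('w discrete \<Rightarrow>\<^sub>C 'f::{real_normed_field,banach}) set"
    and scX :: "'f \<Rightarrow> 'x::banach \<Rightarrow> 'x" and Y \<sigma> K +
  fixes r :: real and u :: "nat \<Rightarrow> 'w discrete \<Rightarrow>\<^sub>C 'f"
    and T :: "'x set" and D :: "nat \<Rightarrow> real" and k0 :: "nat \<Rightarrow> nat"
  assumes closed_B: "closed B" and one_B: "1 \<in> B" and unital: "unital_representation Y \<sigma>"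
    and r_pos: "0 < r" and r_less: "r < 1"
    and u_nonneg: "i \<ge> 1 \<Longrightarrow> u i \<in> nonneg_cone B" and norm_u: "i \<ge> 1 \<Longrightarrow> norm (u i) \<le> 1"
    and T_subset: "T \<subseteq> Y"
    and u_approx: "n \<ge> 1 \<Longrightarrow> k \<ge> k0 n \<Longrightarrow> s \<in> T \<Longrightarrow>
      K * (real n * (1 / (1 - r) ^ Suc k) ^ (2 * n)) * norm (s - \<sigma> (u (Suc k)) s) \<le> D n / 2 ^ Suc k"
begin

section \<open>The elements \<open>b k\<close>, their inverses \<open>c k\<close> and the steps
  between powers\<close>

definition b where "b k = (1 - r) ^ k *\<^sub>R 1 + (\<Sum>i=1..k. (r * (1 - r) ^ (i - 1)) *\<^sub>R u i)"
definition c where "c k = inverse_in B (b k)"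

lemma u_in: "i \<ge> 1 \<Longrightarrow> u i \<in> B"
  using u_nonneg by (simp add: nonneg_cone_def)

lemma b_0: "b 0 = 1"
  by (simp add: b_def)

text \<open>The weight (1 - r)^k still carried by 1 splits into r (1 - r)^k and (1 - r)^(k + 1), and
  the first share passes to \<open>u (Suc k)\<close>.\<close>

lemma b_Suc: "b (Suc k) = b k - (r * (1 - r) ^ k) *\<^sub>R (1 - u (Suc k))"
  by (simp add: b_def algebra_simps)

lemma sum_weights: "(1 - r) ^ k + (\<Sum>i=1..k. r * (1 - r) ^ (i - 1)) = 1"
  by (induction k) (auto simp: algebra_simps)

lemma b_in_hull: "b k \<in> convex hull (insert 1 (u ` {1..k}))"
proof -
  let ?w = "\<lambda>i. if i = 0 then (1 - r) ^ k else r * (1 - r) ^ (i - 1)"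
  let ?v = "\<lambda>i. if i = 0 then 1 else u i"
  have set: "{0..k} = insert 0 {1..k}" by auto
  have "(\<Sum>i\<in>{0..k}. ?w i *\<^sub>R ?v i) \<in> convex hull (insert 1 (u ` {1..k}))"
  proof (rule convex_sum)
    show "sum ?w {0..k} = 1"
      using sum_weights[of k] by (simp add: set)
  qed (use r_pos r_less in \<open>auto intro: hull_inc\<close>)
  also have "(\<Sum>i\<in>{0..k}. ?w i *\<^sub>R ?v i) = b k"
    by (simp add: set b_def)
  finally show ?thesis .
qed

lemma norm_b: "norm (b k) \<le> 1"
proof -
  have "convex hull (insert 1 (u ` {1..k})) \<subseteq> cball 0 1"
    using norm_u by (intro hull_minimal) auto
  then show ?thesis using b_in_hull[of k] by auto
qed

lemma b_in:
  assumes "subalgebra_over scale_fun C" "1 \<in> C" "u ` {1..k} \<subseteq> C"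
  shows "b k \<in> C"
  unfolding b_def using assms
  by (intro subalgebra_add subalgebra_sum subalgebra_scaleR) auto

lemma b_in_B: "b k \<in> B"
  using u_in by (intro b_in subalgebra one_B) auto

lemma b_values: "\<exists>t. (1 - r) ^ k \<le> t \<and> t \<le> 1 \<and> apply_bcontfun (b k) w = of_real t"
proof -
  define t where "t = (1 - r) ^ k + (\<Sum>i=1..k. r * (1 - r) ^ (i - 1) * norm (apply_bcontfun (u i) w))"
  have "apply_bcontfun (b k) w = of_real ((1 - r) ^ k) + (\<Sum>i=1..k. of_real (r * (1 - r) ^ (i - 1)) * apply_bcontfun (u i) w)"
    by (simp add: b_def apply_bcontfun_sum scaleR_field)
  also have "(\<Sum>i=1..k. of_real (r * (1 - r) ^ (i - 1)) * apply_bcontfun (u i) w) =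
      (\<Sum>i=1..k. of_real (r * (1 - r) ^ (i - 1)) * of_real (norm (apply_bcontfun (u i) w)))"
    by (intro sum.cong refl arg_cong2[where f = times] nonneg_cone_norm[OF u_nonneg]) auto
  finally have t: "apply_bcontfun (b k) w = of_real t"
    by (simp add: t_def)
  moreover have lower: "(1 - r) ^ k \<le> t"
    unfolding t_def using r_pos r_less by (auto intro!: sum_nonneg)
  moreover have "t \<le> norm (apply_bcontfun (b k) w)"
    by (simp add: t)
  then have "t \<le> 1" using norm_bounded[of "b k" w] norm_b[of k] by linarith
  ultimately show ?thesis by blast
qed

lemma norm_one_minus_b: "norm (1 - b k) < 1"
proof -
  have "norm (apply_bcontfun (1 - b k) w) \<le> 1 - (1 - r) ^ k" for w
  proof -
    obtain t where t: "(1 - r) ^ k \<le> t" "t \<le> 1" "apply_bcontfun (b k) w = of_real t"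
      using b_values by blast
    have "apply_bcontfun (1 - b k) w = of_real (1 - t)" by (simp add: t)
    then show ?thesis using t by (simp del: of_real_diff)
  qed
  then have "norm (1 - b k) \<le> 1 - (1 - r) ^ k" by (rule norm_bound)
  then show ?thesis using r_less zero_less_power[of "1 - r" k] by linarith
qed

text \<open>Uniqueness of inverses in \<open>B\<close> identifies the Neumann series computed inside
  \<open>C\<close> with \<open>c k\<close>. Taking \<open>C = B\<close> gives invertibility, and all
  \<open>C\<close> together give membership in the generated subalgebra.\<close>

lemma c_in:
  assumes "subalgebra_over scale_fun C" "closed C" "C \<subseteq> B" "1 \<in> C" "u ` {1..k} \<subseteq> C"
  shows "c k \<in> C" and "b k * c k = 1"
proof -
  obtain d where "d \<in> C" "b k * d = 1" "d * b k = 1"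
    using inverse_in_closed_subalgebra[OF assms(1,2,4) b_in[OF assms(1,4,5)] norm_one_minus_b] .
  moreover from this assms(3) have "c k = d" unfolding c_def by (intro inverse_in_eqI) auto
  ultimately show "c k \<in> C" "b k * c k = 1" by auto
qed

lemma c_in_B: "c k \<in> B" and b_c: "b k * c k = 1"
  using c_in[OF subalgebra closed_B order_refl one_B] u_in by (auto simp: image_subset_iff)

lemma invertible_b: "invertible_in B (b k)"
  unfolding invertible_in_def using b_in_B c_in_B[of k] b_c[of k] by (metis mult.commute)

lemma c_generated: "c k \<in> generated_unital_banach_subalgebra scale_fun B (u ` {1..k})"
  unfolding generated_unital_banach_subalgebra_def using c_in by blast

lemma b_nonneg: "b k \<in> nonneg_cone B"
proof -
  obtain t where "\<And>w. (1 - r) ^ k \<le> t w" "\<And>w. apply_bcontfun (b k) w = of_real (t w)"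
    using b_values by metis
  moreover have "0 \<le> (1 - r) ^ k" using r_less by simp
  ultimately show ?thesis
    by (intro nonneg_coneI[where t = t] b_in_B) (auto intro: order_trans)
qed

lemma c_power_nonneg: "c k ^ n \<in> nonneg_cone B"
  using inverse_closed_nonneg_cone[of B] b_nonneg invertible_b
  by (intro nonneg_cone_power subalgebra one_B) (auto simp: inverse_closed_def c_def)

lemma c_0: "c 0 = 1"
  using b_c[of 0] by (simp add: b_0)

lemma norm_c: "norm (c k) \<le> 1 / (1 - r) ^ k"
proof (rule norm_bound)
  fix w
  obtain t where t: "(1 - r) ^ k \<le> t" "apply_bcontfun (b k) w = of_real t"
    using b_values by blast
  have p: "0 < (1 - r) ^ k" using r_less by simp
  have "apply_bcontfun (b k * c k) w = 1" by (simp only: b_c one_bcontfun.rep_eq)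
  then have "of_real t * apply_bcontfun (c k) w = 1" by (simp add: t)
  then have "apply_bcontfun (c k) w = of_real (1 / t)"
    using p t by (simp add: field_simps)
  then show "norm (apply_bcontfun (c k) w) \<le> 1 / (1 - r) ^ k"
    using p t by (simp add: norm_divide frac_le)
qed

lemma norm_c_power: "norm (c k ^ n) \<le> (1 / (1 - r) ^ k) ^ n"
  using norm_power_ineq[of "c k" n] power_mono[OF norm_c, of k n] by simp

lemma c_power_in: "c k ^ n \<in> B"
  by (intro subalgebra_power subalgebra one_B c_in_B)

lemma b_power_c_power: "b k ^ n * c k ^ n = 1"
  by (simp add: power_mult_distrib[symmetric] b_c)

lemma norm_c_power_Suc: "norm (c k ^ n) \<le> (1 / (1 - r) ^ Suc k) ^ n"
proof -
  have "(1 - r) ^ Suc k \<le> (1 - r) ^ k" using r_pos r_less by (simp add: mult_left_le_one_le)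
  then have "1 / (1 - r) ^ k \<le> 1 / (1 - r) ^ Suc k" using r_less by (intro divide_left_mono) auto
  then have "(1 / (1 - r) ^ k) ^ n \<le> (1 / (1 - r) ^ Suc k) ^ n" using r_less by (intro power_mono) auto
  then show ?thesis using norm_c_power[of k n] by linarith
qed

text \<open>The bound on the cofactor does not depend on the \<open>u i\<close>, so the required closeness of
  \<open>\<sigma> (u (Suc k)) s\<close> to \<open>s\<close> can be fixed before any \<open>u i\<close> is chosen.\<close>

lemma c_power_diff:
  obtains G where "G \<in> B" "norm G \<le> real n * (1 / (1 - r) ^ Suc k) ^ (2 * n)"
    "c (Suc k) ^ n - c k ^ n = G * (1 - u (Suc k))"
proof
  define H where "H = (\<Sum>i<n. b (Suc k) ^ (n - Suc i) * b k ^ i)"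
  define G where "G = (r * (1 - r) ^ k) *\<^sub>R (c (Suc k) ^ n * c k ^ n * H)"
  show "G \<in> B"
    unfolding G_def H_def
    by (intro subalgebra_scaleR subalgebra_mult subalgebra_sum subalgebra_power subalgebra one_B b_in_B c_in_B)
  \<comment> \<open>For commuting invertible elements this is 1/p - 1/q = (q - p) / (p q).\<close>
  have "c (Suc k) ^ n - c k ^ n = c (Suc k) ^ n * c k ^ n * (b k ^ n - b (Suc k) ^ n)"
  proof -
    have "c (Suc k) ^ n * c k ^ n * (b k ^ n - b (Suc k) ^ n) =
        c (Suc k) ^ n * (b k ^ n * c k ^ n) - c k ^ n * (b (Suc k) ^ n * c (Suc k) ^ n)"
      by (simp add: algebra_simps)
    then show ?thesis by (simp add: b_power_c_power)
  qed
  also have "b k ^ n - b (Suc k) ^ n = (b k - b (Suc k)) * H"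
    unfolding H_def by (rule power_diff_sumr2)
  also have "b k - b (Suc k) = (r * (1 - r) ^ k) *\<^sub>R (1 - u (Suc k))"
    by (simp add: b_Suc)
  finally show "c (Suc k) ^ n - c k ^ n = G * (1 - u (Suc k))"
    by (simp add: G_def ac_simps)
  \<comment> \<open>Each of the n summands of \<open>H\<close> therefore has norm at most 1,
    whatever the chosen \<open>u i\<close> are.\<close>
  have 1: "norm (b j ^ i) \<le> 1" for i j
    using norm_power_ineq[of "b j" i] power_le_one[OF norm_ge_zero norm_b, of j i] by linarith
  have "norm (b (Suc k) ^ (n - Suc i) * b k ^ i) \<le> 1" for i
    using norm_mult_ineq[of "b (Suc k) ^ (n - Suc i)" "b k ^ i"] mult_mono[OF 1[of "Suc k" "n - Suc i"] 1[of k i]]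
    by auto
  then have H: "norm H \<le> real n"
    unfolding H_def using sum_norm_le[of "{..<n}" "\<lambda>i. b (Suc k) ^ (n - Suc i) * b k ^ i" "\<lambda>_. 1"] by simp
  define q where "q = (1 / (1 - r) ^ Suc k) ^ n"
  have q: "0 \<le> q" using r_less by (simp add: q_def)
  have "norm (c (Suc k) ^ n * c k ^ n) \<le> norm (c (Suc k) ^ n) * norm (c k ^ n)"
    by (rule norm_mult_ineq)
  also have "\<dots> \<le> q * q"
    using norm_c_power[of "Suc k" n] norm_c_power_Suc[of k n] q unfolding q_def[symmetric]
    by (intro mult_mono norm_ge_zero)
  finally have cc: "norm (c (Suc k) ^ n * c k ^ n) \<le> q * q" .
  have "r * (1 - r) ^ k \<le> 1"
    using r_pos r_less by (intro mult_le_one power_le_one) auto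
  then have "norm G \<le> norm (c (Suc k) ^ n * c k ^ n * H)"
    unfolding G_def using r_pos r_less by (simp add: mult_left_le_one_le abs_mult)
  also have "\<dots> \<le> norm (c (Suc k) ^ n * c k ^ n) * norm H"
    by (rule norm_mult_ineq)
  also have "\<dots> \<le> q * q * real n"
    using q by (intro mult_mono cc H) auto
  also have "\<dots> = real n * (1 / (1 - r) ^ Suc k) ^ (2 * n)"
    unfolding q_def mult_2 power_add by (rule mult.commute)
  finally show "norm G \<le> real n * (1 / (1 - r) ^ Suc k) ^ (2 * n)" .
qed

lemma \<sigma>_one: "y \<in> Y \<Longrightarrow> \<sigma> 1 y = y"
  using unital by (simp add: unital_representation_def)

lemma step_bound:
  assumes "n \<ge> 1" "k \<ge> k0 n" "s \<in> T"
  shows "norm (\<sigma> (c (Suc k) ^ n) s - \<sigma> (c k ^ n) s) \<le> D n / 2 ^ Suc k"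
proof -
  have s: "s \<in> Y" using assms T_subset by blast
  obtain G where G: "G \<in> B" "norm G \<le> real n * (1 / (1 - r) ^ Suc k) ^ (2 * n)"
      "c (Suc k) ^ n - c k ^ n = G * (1 - u (Suc k))"
    by (rule c_power_diff)
  have u: "u (Suc k) \<in> B" by (rule u_in) simp
  have "\<sigma> (c (Suc k) ^ n) s - \<sigma> (c k ^ n) s = \<sigma> (G * (1 - u (Suc k))) s"
    using diff_left[OF c_power_in c_power_in s, of "Suc k" n k n] G(3) by simp
  \<comment> \<open>Unitality turns \<open>\<sigma> (1 - u (Suc k)) s\<close> into the difference
    that \<open>u_approx\<close> controls.\<close>
  also have "\<dots> = \<sigma> G (s - \<sigma> (u (Suc k)) s)"
    using mult[OF G(1) subalgebra_diff[OF subalgebra one_B u] s] diff_left[OF one_B u s] by (simp add: \<sigma>_one s)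
  also have "norm \<dots> \<le> K * norm G * norm (s - \<sigma> (u (Suc k)) s)"
    by (intro bound G diff_in_Y maps_to u s)
  also have "\<dots> \<le> K * (real n * (1 / (1 - r) ^ Suc k) ^ (2 * n)) * norm (s - \<sigma> (u (Suc k)) s)"
    using G(2) K_ge_1 by (intro mult_right_mono mult_left_mono) auto
  also have "\<dots> \<le> D n / 2 ^ Suc k"
    by (rule u_approx[OF assms])
  finally show ?thesis .
qed

section \<open>The maps \<open>x n\<close> and their regularity\<close>

definition x where "x n s = lim (\<lambda>k. \<sigma> (c k ^ n) s)"

lemma x_tendsto: "n \<ge> 1 \<Longrightarrow> s \<in> T \<Longrightarrow> (\<lambda>k. \<sigma> (c k ^ n) s) \<longlonglongrightarrow> x n s"
  unfolding x_def convergent_LIMSEQ_iff[symmetric]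
  by (rule geometric_Cauchy_limit(1)[OF step_bound])

lemma x_close: "n \<ge> 1 \<Longrightarrow> s \<in> T \<Longrightarrow> k \<ge> k0 n \<Longrightarrow> norm (x n s - \<sigma> (c k ^ n) s) \<le> D n / 2 ^ k"
  unfolding x_def by (rule geometric_Cauchy_limit(2)[OF step_bound])

lemma D_tendsto: "(\<lambda>k. D n / 2 ^ k) \<longlonglongrightarrow> 0"
  using tendsto_mult[OF tendsto_const LIMSEQ_realpow_zero[of "1 / 2"], of "D n"] by (simp add: power_divide)

lemma small_error:
  assumes "\<eta> > 0"
  obtains k where "k \<ge> k0 n" "D n / 2 ^ k < \<eta>"
proof -
  have "\<forall>\<^sub>F k in sequentially. D n / 2 ^ k < \<eta> \<and> k \<ge> k0 n"
    using assms D_tendsto by (intro eventually_conj order_tendstoD(2) eventually_ge_at_top) auto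
  then obtain k where "D n / 2 ^ k < \<eta> \<and> k \<ge> k0 n"
    using eventually_happens'[OF sequentially_bot] by blast
  then show ?thesis
    using that by blast
qed

lemma x_in_closed:
  assumes "n \<ge> 1" "s \<in> T" "closed V" "\<And>k. \<sigma> (c k ^ n) s \<in> V"
  shows "x n s \<in> V"
  by (rule closed_sequentially[OF assms(3) _ x_tendsto[OF assms(1,2)]]) (rule assms(4))

lemma x_in_Y: "n \<ge> 1 \<Longrightarrow> s \<in> T \<Longrightarrow> x n s \<in> Y"
  using T_subset by (intro x_in_closed closed_Y maps_to c_power_in) auto

text \<open>On all of \<open>T\<close> at once, \<open>x n\<close> is within
  \<open>D n / 2 ^ k\<close> of the Lipschitz map \<open>\<sigma> (c k ^ n)\<close>; a uniform limit
  of uniformly continuous maps is uniformly continuous.\<close>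

lemma uniformly_continuous_x:
  assumes "n \<ge> 1"
  shows "uniformly_continuous_on T (x n)"
  unfolding uniformly_continuous_on_def
proof (intro allI impI)
  fix \<eta> :: real assume \<eta>: "\<eta> > 0"
  then have "\<eta> / 3 > 0" by simp
  then obtain k where k: "k \<ge> k0 n" "D n / 2 ^ k < \<eta> / 3"
    by (rule small_error)
  let ?y = "\<sigma> (c k ^ n)"
  define q where "q = K * norm (c k ^ n) + 1"
  have "0 \<le> K * norm (c k ^ n)" using K_ge_1 by simp
  then have q: "q > 0" "K * norm (c k ^ n) \<le> q" by (auto simp: q_def)
  show "\<exists>d>0. \<forall>s\<in>T. \<forall>s'\<in>T. dist s' s < d \<longrightarrow> dist (x n s') (x n s) < \<eta>"
  proof (intro exI[of _ "\<eta> / 3 / q"] conjI ballI impI)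
    show "0 < \<eta> / 3 / q" using \<eta> q by simp
    fix s s' assume s: "s \<in> T" "s' \<in> T" and d: "dist s' s < \<eta> / 3 / q"
    then have sY: "s \<in> Y" "s' \<in> Y" using T_subset by auto
    have "norm (?y s' - ?y s) = norm (?y (s' - s))"
      by (simp add: diff_right[OF c_power_in sY(2,1)])
    also have "\<dots> \<le> K * norm (c k ^ n) * norm (s' - s)"
      by (rule bound[OF c_power_in diff_in_Y[OF sY(2,1)]])
    also have "\<dots> \<le> q * norm (s' - s)"
      by (rule mult_right_mono[OF q(2) norm_ge_zero])
    also have "\<dots> < \<eta> / 3"
      using d unfolding dist_norm pos_less_divide_eq[OF q(1)] mult.commute[of q] .
    finally have "norm (?y s' - ?y s) < \<eta> / 3" .
    moreover have "norm (x n s' - x n s) \<le> norm (x n s' - ?y s') + norm (?y s' - ?y s) + norm (x n s - ?y s)"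
      using norm_triangle_ineq[of "x n s' - ?y s'" "?y s' - x n s"] norm_triangle_ineq[of "?y s' - ?y s" "?y s - x n s"]
        norm_minus_commute[of "x n s" "?y s"] by simp
    ultimately show "dist (x n s') (x n s) < \<eta>"
      using x_close[OF assms s(1) k(1)] x_close[OF assms s(2) k(1)] k(2) unfolding dist_norm by linarith
  qed
qed

lemma x_add:
  assumes "n \<ge> 1" "s \<in> T" "s' \<in> T" "s + s' \<in> T"
  shows "x n (s + s') = x n s + x n s'"
proof (rule LIMSEQ_unique[OF x_tendsto[OF assms(1,4)]])
  have "\<sigma> (c k ^ n) (s + s') = \<sigma> (c k ^ n) s + \<sigma> (c k ^ n) s'" for k
    by (rule add_right[OF c_power_in]) (use assms T_subset in blast)+
  then show "(\<lambda>k. \<sigma> (c k ^ n) (s + s')) \<longlonglongrightarrow> x n s + x n s'"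
    by (simp only: tendsto_add[OF x_tendsto[OF assms(1,2)] x_tendsto[OF assms(1,3)]])
qed

lemma x_scale:
  assumes "n \<ge> 1" "s \<in> T" "scX \<mu> s \<in> T"
  shows "x n (scX \<mu> s) = scX \<mu> (x n s)"
proof (rule LIMSEQ_unique[OF x_tendsto[OF assms(1,3)]])
  have "\<sigma> (c k ^ n) (scX \<mu> s) = scX \<mu> (\<sigma> (c k ^ n) s)" for k
    by (rule scale_right[OF c_power_in]) (use assms T_subset in blast)+
  then show "(\<lambda>k. \<sigma> (c k ^ n) (scX \<mu> s)) \<longlonglongrightarrow> scX \<mu> (x n s)"
    by (simp only: bounded_linear.tendsto[OF bounded_linear_scX[OF space] x_tendsto[OF assms(1,2)]])
qed

text \<open>As \<open>\<sigma> v\<close> commutes with \<open>\<sigma> (c k ^ n)\<close>, it moves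
  \<open>\<sigma> (c k ^ n) s\<close> by the image of \<open>\<sigma> v s - s\<close>; the first
  summand pays for exchanging \<open>x n s\<close> with that vector. Used with
  \<open>v = e i\<close> for the uniform convergence on the image of \<open>T\<close>.\<close>

lemma x_approx:
  assumes "n \<ge> 1" "s \<in> T" "k \<ge> k0 n" "v \<in> B" "norm v \<le> 1"
  shows "norm (\<sigma> v (x n s) - x n s) \<le> (K + 1) * (D n / 2 ^ k) + K * norm (c k ^ n) * norm (\<sigma> v s - s)"
proof -
  let ?y = "\<sigma> (c k ^ n) s"
  have s: "s \<in> Y" using assms T_subset by blast
  have y: "?y \<in> Y" by (intro maps_to c_power_in s)
  note xY = x_in_Y[OF assms(1,2)]
  have "\<sigma> v ?y = \<sigma> (c k ^ n) (\<sigma> v s)"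
    using mult[OF assms(4) c_power_in s] mult[OF c_power_in assms(4) s] by (metis mult.commute)
  then have eq: "\<sigma> v (x n s) - x n s = \<sigma> v (x n s - ?y) + \<sigma> (c k ^ n) (\<sigma> v s - s) + (?y - x n s)"
    using diff_right[OF assms(4) xY y] diff_right[OF c_power_in maps_to[OF assms(4) s] s] by simp
  have "norm (\<sigma> v (x n s - ?y)) \<le> K * (D n / 2 ^ k)"
  proof -
    have "norm (\<sigma> v (x n s - ?y)) \<le> K * norm v * norm (x n s - ?y)"
      by (intro bound assms diff_in_Y xY y)
    also have "\<dots> \<le> K * 1 * (D n / 2 ^ k)"
      using assms(5) x_close[OF assms(1-3)] K_ge_1 by (intro mult_mono) auto
    finally show ?thesis by simp
  qed
  moreover have "norm (\<sigma> (c k ^ n) (\<sigma> v s - s)) \<le> K * norm (c k ^ n) * norm (\<sigma> v s - s)"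
    by (intro bound c_power_in diff_in_Y maps_to assms s)
  moreover have "norm (?y - x n s) \<le> D n / 2 ^ k"
    using x_close[OF assms(1-3)] by (simp add: norm_minus_commute)
  moreover have "norm (\<sigma> v (x n s) - x n s) \<le>
      norm (\<sigma> v (x n s - ?y)) + norm (\<sigma> (c k ^ n) (\<sigma> v s - s)) + norm (?y - x n s)"
    unfolding eq by norm
  ultimately show ?thesis
    unfolding distrib_right mult_1 by linarith
qed

section \<open>The factor \<open>a\<close> and the factorization identity\<close>

definition a where "a = (\<Sum>i. (r * (1 - r) ^ i) *\<^sub>R u (Suc i))"

lemma a_sums: "(\<lambda>i. (r * (1 - r) ^ i) *\<^sub>R u (Suc i)) sums a"
  unfolding a_def
proof (rule summable_sums, rule summable_comparison_test)
  show "\<exists>N. \<forall>i\<ge>N. norm ((r * (1 - r) ^ i) *\<^sub>R u (Suc i)) \<le> r * (1 - r) ^ i"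
    using r_pos r_less norm_u by (auto simp: mult_left_le)
  show "summable (\<lambda>i. r * (1 - r) ^ i)"
    using r_pos r_less by (intro summable_mult summable_geometric) auto
qed

lemma power_tendsto_0: "(\<lambda>k. (1 - r) ^ k) \<longlonglongrightarrow> 0"
  using r_pos r_less by (intro LIMSEQ_realpow_zero) auto

lemma b_eq: "b k = (1 - r) ^ k *\<^sub>R 1 + (\<Sum>i<k. (r * (1 - r) ^ i) *\<^sub>R u (Suc i))"
  by (simp add: b_def sum.atLeast1_atMost_eq)

lemma b_tendsto: "b \<longlonglongrightarrow> a"
proof -
  have "(\<lambda>k. (1 - r) ^ k *\<^sub>R 1 + (\<Sum>i<k. (r * (1 - r) ^ i) *\<^sub>R u (Suc i))) \<longlonglongrightarrow> 0 *\<^sub>R 1 + a"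
    using a_sums unfolding sums_def by (intro tendsto_intros power_tendsto_0)
  then show ?thesis by (simp add: b_eq[abs_def])
qed

lemma norm_a: "norm a \<le> 1"
  using tendsto_norm[OF b_tendsto] by (rule LIMSEQ_le_const2) (use norm_b in blast)

lemma a_nonneg: "a \<in> nonneg_cone B"
  using closed_nonneg_cone[OF closed_B] b_nonneg b_tendsto closed_sequentially by blast

lemma a_in:
  assumes "subalgebra_over scale_fun C" "closed C" "\<And>i. i \<ge> 1 \<Longrightarrow> u i \<in> C"
  shows "a \<in> C"
  using a_sums assms(2) unfolding sums_def
  by (elim closed_sequentially[rotated 2]) (auto intro!: subalgebra_sum subalgebra_scaleR assms)

lemma a_in_hull: "a \<in> closure (convex hull (u ` {1..}))"
proof -
  \<comment> \<open>The partial sums of the series lack the weight (1 - r)^k. Given to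
    \<open>u 1\<close> instead of 1, it makes them convex combinations of the \<open>u i\<close>,
    and it vanishes in the limit.\<close>
  let ?h = "\<lambda>k. (1 - r) ^ k *\<^sub>R u 1 + (\<Sum>i=1..k. (r * (1 - r) ^ (i - 1)) *\<^sub>R u i)"
  have "?h k \<in> convex hull (u ` {1..})" for k
  proof -
    let ?w = "\<lambda>i. if i = 0 then (1 - r) ^ k else r * (1 - r) ^ (i - 1)"
    let ?v = "\<lambda>i. if i = 0 then u 1 else u i"
    have set: "{0..k} = insert 0 {1..k}" by auto
    have "(\<Sum>i\<in>{0..k}. ?w i *\<^sub>R ?v i) \<in> convex hull (u ` {1..})"
    proof (rule convex_sum)
      show "sum ?w {0..k} = 1"
        using sum_weights[of k] by (simp add: set)
    qed (use r_pos r_less in \<open>auto intro: hull_inc\<close>)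
    then show ?thesis by (simp add: set)
  qed
  moreover have "?h \<longlonglongrightarrow> 0 *\<^sub>R u 1 + a"
    using a_sums unfolding sums_def
    by (intro tendsto_intros power_tendsto_0) (simp add: sum.atLeast1_atMost_eq)
  ultimately show ?thesis
    unfolding closure_sequential by (intro exI[of _ ?h]) auto
qed

lemma a_power_in: "a ^ n \<in> B"
  using a_nonneg by (intro subalgebra_power subalgebra one_B) (simp add: nonneg_cone_def)

text \<open>\<open>b k ^ n\<close> inverts \<open>c k ^ n\<close> and tends to \<open>a ^ n\<close>.
  Since its norm stays at most 1, the error from replacing \<open>\<sigma> (c k ^ n) s\<close> by
  its limit \<open>x n s\<close> is not magnified, and both limits can be taken together.\<close>

lemma factorization:
  assumes "n \<ge> 1" "s \<in> T"
  shows "\<sigma> (a ^ n) (x n s) = s"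
proof -
  have s: "s \<in> Y" using assms T_subset by blast
  note xY = x_in_Y[OF assms]
  have bB: "b k ^ n \<in> B" for k by (intro subalgebra_power subalgebra one_B b_in_B)
  have "(\<lambda>k. \<sigma> (b k ^ n) (x n s)) \<longlonglongrightarrow> \<sigma> (a ^ n) (x n s)"
    using bB by (intro tendsto_left tendsto_power b_tendsto a_power_in xY) auto
  moreover have "(\<lambda>k. \<sigma> (b k ^ n) (x n s)) \<longlonglongrightarrow> s"
  proof (rule Lim_transform_bound[where g = "\<lambda>k. K * norm (x n s - \<sigma> (c k ^ n) s)", THEN Lim_null[THEN iffD2]])
    show "(\<lambda>k. K * norm (x n s - \<sigma> (c k ^ n) s)) \<longlonglongrightarrow> 0"
      using x_tendsto[OF assms] by (auto intro!: tendsto_eq_intros)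
    show "\<forall>\<^sub>F k in sequentially. norm (\<sigma> (b k ^ n) (x n s) - s) \<le> norm (K * norm (x n s - \<sigma> (c k ^ n) s))"
    proof (intro always_eventually allI)
      fix k
      have y: "\<sigma> (c k ^ n) s \<in> Y" by (intro maps_to c_power_in s)
      have "\<sigma> (b k ^ n) (\<sigma> (c k ^ n) s) = s"
        using mult[OF bB c_power_in s, of k k n] by (simp add: b_power_c_power \<sigma>_one s)
      then have "\<sigma> (b k ^ n) (x n s) - s = \<sigma> (b k ^ n) (x n s - \<sigma> (c k ^ n) s)"
        using diff_right[OF bB xY y] by simp
      also have "norm \<dots> \<le> K * norm (b k ^ n) * norm (x n s - \<sigma> (c k ^ n) s)"
        by (intro bound bB diff_in_Y xY y)
      also have "\<dots> \<le> K * 1 * norm (x n s - \<sigma> (c k ^ n) s)"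
        using norm_power_ineq[of "b k" n] power_le_one[OF norm_ge_zero norm_b, of k n] K_ge_1
        by (intro mult_right_mono mult_left_mono) auto
      finally show "norm (\<sigma> (b k ^ n) (x n s) - s) \<le> norm (K * norm (x n s - \<sigma> (c k ^ n) s))"
        using K_ge_1 by simp
    qed
  qed
  ultimately show ?thesis
    by (rule LIMSEQ_unique)
qed

lemma homeomorphism_x:
  assumes "n \<ge> 1"
  shows "homeomorphism T (x n ` T) (x n) (\<sigma> (a ^ n))"
  unfolding homeomorphism_def
proof (intro conjI)
  show "continuous_on (x n ` T) (\<sigma> (a ^ n))"
    by (rule continuous_on_subset[OF continuous_on_right[OF a_power_in]]) (use x_in_Y assms in auto)
qed (use assms factorization in \<open>auto simp: image_image uniformly_continuous_x uniformly_continuous_imp_continuous\<close>)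

end

section \<open>Simultaneous power factorization\<close>

lemma finite_positive_lower_bound:
  fixes g :: "'i \<Rightarrow> real"
  assumes "finite I" and "\<And>i. i \<in> I \<Longrightarrow> g i > 0"
  obtains \<eta> where "\<eta> > 0" "\<And>i. i \<in> I \<Longrightarrow> \<eta> \<le> g i"
  \<comment> \<open>The inserted 1 keeps \<open>Min\<close> meaningful when \<open>I\<close> is
    empty.\<close>
  by (rule that[of "Min (insert 1 (g ` I))"]) (use assms in auto)

text \<open>Without a largest element some h fails to lie below i. An upper bound of i and h is then
  strictly above i, as otherwise h would lie below i by transitivity; taken beyond the threshold of
  \<open>P k\<close> as well, it is the next element.\<close>

lemma chain_in_directed_set:
  assumes dir: "directed_set L le"
    and P: "\<And>k. \<forall>\<^sub>F i in net_filter L le. P k i"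
  obtains l where "\<And>k. l k \<in> L" "\<And>k. P k (l (Suc k))" "\<And>k. le (l k) (l (Suc k))"
    "\<And>k. (\<nexists>m. m \<in> L \<and> (\<forall>i\<in>L. le i m)) \<Longrightarrow> \<not> le (l (Suc k)) (l k)"
proof -
  have trans: "\<And>i j k. i \<in> L \<Longrightarrow> j \<in> L \<Longrightarrow> k \<in> L \<Longrightarrow> le i j \<Longrightarrow> le j k \<Longrightarrow> le i k"
    and ub: "\<And>i j. i \<in> L \<Longrightarrow> j \<in> L \<Longrightarrow> \<exists>k\<in>L. le i k \<and> le j k"
    using dir unfolding directed_set_def by (blast dest: transp_onD)+
  let ?nolargest = "\<nexists>m. m \<in> L \<and> (\<forall>i\<in>L. le i m)"
  have "\<exists>l. \<forall>k. l k \<in> L \<and> (le (l k) (l (Suc k)) \<and> P k (l (Suc k)) \<and> (?nolargest \<longrightarrow> \<not> le (l (Suc k)) (l k)))"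
  proof (rule dependent_nat_choice)
    show "\<exists>i. i \<in> L" using dir by (auto simp: directed_set_def)
    fix i k assume i: "i \<in> L"
    obtain t where t: "t \<in> L" "\<And>j. j \<in> L \<Longrightarrow> le t j \<Longrightarrow> P k j"
      using P[of k] unfolding eventually_net_filter[OF dir] by blast
    obtain h where h: "h \<in> L" "?nolargest \<Longrightarrow> \<not> le h i"
      using i by blast
    obtain j where j: "j \<in> L" "le i j" "le t j" using ub i t by blast
    obtain j' where j': "j' \<in> L" "le j j'" "le h j'" using ub j h by blast
    have "le i j'" "le t j'" using trans i t j j' by blast+
    moreover have "\<not> le j' i" if ?nolargest
      using trans[OF h(1) j'(1) i j'(3)] h(2)[OF that] by blast
    ultimately show "\<exists>j. j \<in> L \<and> (le i j \<and> P k j \<and> (?nolargest \<longrightarrow> \<not> le j i))"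
      using j'(1) t(2) by blast
  qed
  then obtain l where l: "\<And>k. l k \<in> L" "\<And>k. le (l k) (l (Suc k)) \<and> P k (l (Suc k)) \<and> (?nolargest \<longrightarrow> \<not> le (l (Suc k)) (l k))"
    by blast
  show ?thesis
    by (rule that[of l]) (use l in auto)
qed

text \<open>The threshold \<open>k0 n\<close> is the last stage \<open>k\<close> with \<open>(K + 1) / (1 - r)\<^sup>k \<le> \<alpha> n\<close> (or \<open>0\<close>), where the bound
  \<open>K (1 - r)\<^sup>-\<^sup>k\<^sup>n\<close> on the norm of \<open>\<sigma> (b\<^sub>k\<^sup>-\<^sup>n)\<close> is still below \<open>\<alpha> n ^ n\<close>. A given stage has to control only
  finitely many \<open>n\<close>, since \<open>\<alpha>\<close> tends to infinity.\<close>

lemma approximating_sequence_exists: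
  fixes B :: "('w discrete \<Rightarrow>\<^sub>C 'f::{real_normed_field,banach}) set"
    and scX :: "'f \<Rightarrow> 'x::banach \<Rightarrow> 'x"
  assumes dir: "directed_set L le"
    and ul: "uniform_limit T (\<lambda>i s. \<sigma> (e i) s) (\<lambda>s. s) (net_filter L le)"
    and K: "K \<ge> 1" and r: "0 < r" "r < 1"
    and \<alpha>: "filterlim \<alpha> at_top sequentially"
    and D: "\<And>n. n \<ge> 1 \<Longrightarrow> D n > 0"
  obtains l k0 where "\<And>k. l k \<in> L" "\<And>k. le (l k) (l (Suc k))"
    "\<And>k. (\<nexists>m. m \<in> L \<and> (\<forall>i\<in>L. le i m)) \<Longrightarrow> \<not> le (l (Suc k)) (l k)"
    "\<And>n. n \<le> n0 \<Longrightarrow> k0 n = 0"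
    "\<And>n. k0 n = 0 \<or> (K + 1) * (1 / (1 - r)) ^ k0 n \<le> \<alpha> n"
    "\<And>n k s. n \<ge> 1 \<Longrightarrow> k \<ge> k0 n \<Longrightarrow> s \<in> T \<Longrightarrow>
      K * (real n * (1 / (1 - r) ^ Suc k) ^ (2 * n)) * norm (s - \<sigma> (e (l (Suc k))) s) \<le> D n / 2 ^ Suc k"
proof -
  define \<beta> where "\<beta> k = (K + 1) * (1 / (1 - r)) ^ k" for k
  have q: "1 / (1 - r) > 1" using r by simp
  have \<beta>_mono: "\<beta> j \<le> \<beta> k" if "j \<le> k" for j k
    unfolding \<beta>_def using q K that by (intro mult_left_mono power_increasing) auto
  have \<beta>_unbounded: "\<exists>k. z < \<beta> (Suc k)" for z
  proof -
    obtain k where k: "z < (1 / (1 - r)) ^ k" using real_arch_pow[OF q] by blast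
    have "(1 / (1 - r)) ^ k \<le> (1 / (1 - r)) ^ Suc k" using q by (intro power_increasing) auto
    also have "\<dots> = 1 * (1 / (1 - r)) ^ Suc k" by simp
    also have "\<dots> \<le> \<beta> (Suc k)" unfolding \<beta>_def using K r by (intro mult_right_mono) auto
    finally show ?thesis using k by (intro exI[of _ k]) linarith
  qed
  \<comment> \<open>This is the set of all n \<ge> 1 with \<open>k0 n \<le> k\<close>, written in
    terms of \<beta>, which increases with k.\<close>
  define I where "I k = {n. 1 \<le> n \<and> (n \<le> n0 \<or> \<alpha> n < \<beta> (Suc k))}" for k
  define C where "C k n = K * (real n * (1 / (1 - r) ^ Suc k) ^ (2 * n))" for k n
  have C: "C k n \<ge> 0" for k n unfolding C_def using K r by simp
  have "\<exists>\<eta>>0. \<forall>n\<in>I k. C k n * \<eta> \<le> D n / 2 ^ Suc k" for k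
  proof -
    have "\<forall>\<^sub>F n in sequentially. \<alpha> n \<ge> \<beta> (Suc k)"
      using \<alpha> by (simp add: filterlim_at_top)
    then obtain N where N: "\<And>n. n \<ge> N \<Longrightarrow> \<alpha> n \<ge> \<beta> (Suc k)"
      by (auto simp: eventually_sequentially)
    have "I k \<subseteq> {..max n0 N}"
    proof
      fix n assume n: "n \<in> I k"
      then show "n \<in> {..max n0 N}" using N[of n] unfolding I_def by (cases "n \<ge> N") auto
    qed
    then have fin: "finite (I k)" by (rule finite_subset) simp
    \<comment> \<open>The added 1 makes the denominator positive from \<open>C k n \<ge> 0\<close>
      alone.\<close>
    have "D n / 2 ^ Suc k / (C k n + 1) > 0" if "n \<in> I k" for n
    proof -
      have "C k n + 1 > 0" using C[of k n] by linarith
      then show ?thesis using D[of n] that by (simp add: I_def)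
    qed
    then obtain \<eta> where \<eta>: "\<eta> > 0" "\<And>n. n \<in> I k \<Longrightarrow> \<eta> \<le> D n / 2 ^ Suc k / (C k n + 1)"
      using finite_positive_lower_bound[OF fin, of "\<lambda>n. D n / 2 ^ Suc k / (C k n + 1)"] by blast
    have "C k n * \<eta> \<le> D n / 2 ^ Suc k" if n: "n \<in> I k" for n
    proof -
      have C1: "C k n + 1 > 0" using C[of k n] by linarith
      have "C k n * \<eta> \<le> \<eta> * (C k n + 1)" using \<eta>(1) by (simp add: algebra_simps)
      also have "\<dots> \<le> D n / 2 ^ Suc k"
        using \<eta>(2)[OF n] unfolding pos_le_divide_eq[OF C1] .
      finally show ?thesis .
    qed
    then show ?thesis using \<eta>(1) by blast
  qed
  then obtain \<eta> where \<eta>: "\<And>k. \<eta> k > 0" "\<And>k n. n \<in> I k \<Longrightarrow> C k n * \<eta> k \<le> D n / 2 ^ Suc k"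
    by metis
  obtain l where l: "\<And>k. l k \<in> L" "\<And>k. \<forall>s\<in>T. dist (\<sigma> (e (l (Suc k))) s) s < \<eta> k"
      "\<And>k. le (l k) (l (Suc k))" "\<And>k. (\<nexists>m. m \<in> L \<and> (\<forall>i\<in>L. le i m)) \<Longrightarrow> \<not> le (l (Suc k)) (l k)"
    using chain_in_directed_set[OF dir, of "\<lambda>k i. \<forall>s\<in>T. dist (\<sigma> (e i) s) s < \<eta> k"] uniform_limitD[OF ul \<eta>(1)]
    by blast
  \<comment> \<open>For \<open>n \<le> n0\<close> control starts at stage 0, because there
    \<open>x n s\<close> has to stay close to s itself, the value at stage 0.\<close>
  define k0 where "k0 n = (if n \<le> n0 then 0 else LEAST k. \<alpha> n < \<beta> (Suc k))" for n
  show ?thesis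
  proof (rule that[of l k0])
    show "k0 n = 0" if "n \<le> n0" for n using that by (simp add: k0_def)
    show "k0 n = 0 \<or> (K + 1) * (1 / (1 - r)) ^ k0 n \<le> \<alpha> n" for n
    proof (cases "n \<le> n0 \<or> k0 n = 0")
      case False
      then obtain j where j: "k0 n = Suc j" "(LEAST k. \<alpha> n < \<beta> (Suc k)) = Suc j"
        by (metis k0_def not0_implies_Suc)
      \<comment> \<open>Minimality is used at j, one below \<open>k0 n = Suc j\<close>. Because the
        definition of \<open>k0\<close> looks one stage ahead, it gives the bound at
        \<open>k0 n\<close> itself.\<close>
      have "\<not> \<alpha> n < \<beta> (Suc j)"
        by (rule not_less_Least) (simp add: j(2))
      then show ?thesis
        unfolding j(1) \<beta>_def[symmetric] by simp
    qed (auto simp: k0_def)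
    fix n k s assume n: "n \<ge> 1" and k: "k \<ge> k0 n" and s: "s \<in> T"
    have "n \<in> I k"
    proof (cases "n \<le> n0")
      case False
      have "\<alpha> n < \<beta> (Suc (k0 n))"
        using LeastI_ex[OF \<beta>_unbounded[of "\<alpha> n"]] False by (simp add: k0_def)
      also have "\<dots> \<le> \<beta> (Suc k)" using k by (intro \<beta>_mono) simp
      finally show ?thesis using n by (simp add: I_def)
    qed (use n in \<open>simp add: I_def\<close>)
    have "C k n * norm (s - \<sigma> (e (l (Suc k))) s) \<le> C k n * \<eta> k"
      using l(2)[of k] s C[of k n] by (intro mult_left_mono) (auto simp: dist_norm norm_minus_commute intro: less_imp_le)
    also have "\<dots> \<le> D n / 2 ^ Suc k"
      by (rule \<eta>(2)) fact
    finally show "K * (real n * (1 / (1 - r) ^ Suc k) ^ (2 * n)) * norm (s - \<sigma> (e (l (Suc k))) s) \<le> D n / 2 ^ Suc k"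
      unfolding C_def .
  qed (use l in auto)
qed

text \<open>Of the cone \<open>YP\<close> only closedness and stability under positive elements of
  \<open>B\<close> enter: the inverse powers \<open>S.c k ^ n\<close> are positive, so the limits
  defining \<open>x n\<close> stay in \<open>YP\<close>.\<close>

lemma simultaneous_power_factorization_exists:
  fixes B :: "('w discrete \<Rightarrow>\<^sub>C 'f::{real_normed_field,banach}) set"
    and scX :: "'f \<Rightarrow> 'x::banach \<Rightarrow> 'x"
  assumes rep: "bounded_representation B scX Y \<sigma> K"
    and B: "closed B" "1 \<in> B" and unital: "unital_representation Y \<sigma>"
    and A: "subalgebra_over scale_fun A" "closed A" "A \<subseteq> B"
    and ai: "positive_left_approximate_identity A (nonneg_cone A) 1 L le e"
    and T: "T \<subseteq> YP" and YP: "YP \<subseteq> Y" "closed YP" "positive_representation (nonneg_cone B) YP \<sigma>"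
    and ul: "uniform_limit T (\<lambda>i s. \<sigma> (e i) s) (\<lambda>s. s) (net_filter L le)"
    and pos: "\<epsilon> > 0" "\<delta> > 0" and r: "0 < r" "r < 1"
    and \<alpha>1: "\<And>n. n \<ge> 1 \<Longrightarrow> \<alpha> n > 1" and \<alpha>: "filterlim \<alpha> at_top sequentially"
  shows "\<exists>a x. simultaneous_power_factorization scale_fun A B 1 L le e scX Y \<sigma> T \<epsilon> \<delta> r n0 \<alpha> a x \<and>
           a \<in> nonneg_cone A \<and> (\<forall>n\<ge>1. x n ` T \<subseteq> YP) \<and> norm a \<le> 1"
proof -
  interpret R: bounded_representation B scX Y \<sigma> K by (rule rep)
  have dir: "directed_set L le" and e: "\<And>i. i \<in> L \<Longrightarrow> e i \<in> nonneg_cone A" "\<And>i. i \<in> L \<Longrightarrow> norm (e i) \<le> 1"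
    using ai by (auto simp: positive_left_approximate_identity_def left_approximate_identity_def)
  have eA: "\<And>i. i \<in> L \<Longrightarrow> e i \<in> A" and eB: "\<And>i. i \<in> L \<Longrightarrow> e i \<in> nonneg_cone B"
    using e(1) A(3) by (auto simp: nonneg_cone_def)
  \<comment> \<open>Here \<epsilon> serves the closeness to s for \<open>n \<le> n0\<close>, the
    last term serves the growth bound when \<open>k0 n = 0\<close>, and \<delta> makes the movement
    at most \<open>max (norm s) \<delta>\<close> when \<open>k0 n > 0\<close>.\<close>
  define D where "D n = min \<epsilon> (min \<delta> ((\<alpha> n ^ n - 1) * \<delta>))" for n
  have \<alpha>n: "\<alpha> n ^ n > 1" if "n \<ge> 1" for n
    using \<alpha>1[OF that] that by (intro one_less_power) auto
  then have D_pos: "D n > 0" if "n \<ge> 1" for n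
    using that pos by (simp add: D_def)
  obtain l k0 where l: "\<And>k. l k \<in> L" "\<And>k. le (l k) (l (Suc k))"
      "\<And>k. (\<nexists>m. m \<in> L \<and> (\<forall>i\<in>L. le i m)) \<Longrightarrow> \<not> le (l (Suc k)) (l k)"
    and k0: "\<And>n. n \<le> n0 \<Longrightarrow> k0 n = 0" "\<And>n. k0 n = 0 \<or> (K + 1) * (1 / (1 - r)) ^ k0 n \<le> \<alpha> n"
    and u_approx: "\<And>n k s. n \<ge> 1 \<Longrightarrow> k \<ge> k0 n \<Longrightarrow> s \<in> T \<Longrightarrow>
      K * (real n * (1 / (1 - r) ^ Suc k) ^ (2 * n)) * norm (s - \<sigma> (e (l (Suc k))) s) \<le> D n / 2 ^ Suc k"
    by (rule approximating_sequence_exists[where \<sigma> = \<sigma> and e = e and ?n0.0 = n0 and D = D,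
          OF dir ul R.K_ge_1 r \<alpha>]) (assumption | rule D_pos that | blast)+
  define u where "u k = e (l k)" for k
  interpret S: factorization_sequence B scX Y \<sigma> K r u T D k0
    using B unital r T YP(1) eB e(2) l(1) u_approx
    by unfold_locales (auto simp: u_def)

  have x_YP: "S.x n s \<in> YP" if "n \<ge> 1" "s \<in> T" for n s
  proof (rule S.x_in_closed[OF that YP(2)])
    show "\<sigma> (S.c k ^ n) s \<in> YP" for k
      using YP(3) S.c_power_nonneg that T unfolding positive_representation_def by blast
  qed
  have a_A: "S.a \<in> A"
    using l eA by (intro S.a_in A) (auto simp: u_def)
  have a_pos: "S.a \<in> nonneg_cone A"
    using a_A S.a_nonneg by (simp add: nonneg_cone_def)

  have close: "norm (s - S.x n s) \<le> \<epsilon>" if "1 \<le> n" "n \<le> n0" "s \<in> T" for n s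
  proof -
    have "s \<in> Y" using that T YP by blast
    then have "norm (S.x n s - s) \<le> D n"
      using S.x_close[of n s 0] that k0(1)[of n] by (simp add: S.c_0 S.\<sigma>_one)
    then show ?thesis by (simp add: D_def norm_minus_commute)
  qed

  have growth: "norm (S.x n s) \<le> \<alpha> n ^ n * max (norm s) \<delta>" if n: "n \<ge> 1" and s: "s \<in> T" for n s
  proof -
    let ?m = "max (norm s) \<delta>"
    have sY: "s \<in> Y" using s T YP by blast
    have m: "?m \<ge> 0" "norm s \<le> ?m" "\<delta> \<le> ?m" by (auto simp: le_max_iff_disj)
    have "norm (S.x n s - \<sigma> (S.c (k0 n) ^ n) s) \<le> D n / 2 ^ k0 n"
      by (rule S.x_close[OF n s order_refl])
    also have "\<dots> \<le> D n"
      using D_pos[OF n] by (simp add: divide_le_eq mult_left_le_one_le)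
    finally have *: "norm (S.x n s) \<le> norm (\<sigma> (S.c (k0 n) ^ n) s) + D n"
      using norm_triangle_sub[of "S.x n s" "\<sigma> (S.c (k0 n) ^ n) s"] by linarith
    show ?thesis
    proof (cases "k0 n = 0")
      case True
      have "D n \<le> (\<alpha> n ^ n - 1) * \<delta>" by (simp add: D_def)
      also have "\<dots> \<le> (\<alpha> n ^ n - 1) * ?m" using \<alpha>n[OF n] m by (intro mult_left_mono) auto
      finally have "norm s + D n \<le> ?m + (\<alpha> n ^ n - 1) * ?m" using m by linarith
      then show ?thesis
        using * True by (simp add: S.c_0 S.\<sigma>_one sY algebra_simps)
    next
      case False
      define q where "q = (1 / (1 - r)) ^ k0 n"
      have q: "q \<ge> 1" unfolding q_def using r by (intro one_le_power) simp
      have "norm (\<sigma> (S.c (k0 n) ^ n) s) \<le> K * norm (S.c (k0 n) ^ n) * norm s"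
        by (rule R.bound[OF S.c_power_in sY])
      also have "\<dots> \<le> K * q ^ n * ?m"
        using S.norm_c_power[of "k0 n" n] R.K_ge_1 q m r
        by (intro mult_mono) (auto simp: q_def power_one_over zero_le_divide_iff)
      also have "\<dots> + D n \<le> K * q ^ n * ?m + 1 * ?m"
        using m(3) by (simp add: D_def)
      also have "\<dots> \<le> (K + 1) * q ^ n * ?m"
      proof -
        have "1 * ?m \<le> q ^ n * ?m" using q m by (intro mult_right_mono one_le_power) auto
        then show ?thesis by (simp add: algebra_simps)
      qed
      also have "\<dots> \<le> \<alpha> n ^ n * ?m"
      proof (intro mult_right_mono m)
        \<comment> \<open>In K + 1 the K is the operator bound and the 1 pays for the movement
          \<open>D n\<close>. As n \<ge> 1, this constant may be raised to the power n, so the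
          condition on \<open>k0 n\<close> can be stated without n-th powers.\<close>
        have "(K + 1) * q ^ n \<le> (K + 1) ^ n * q ^ n"
          using R.K_ge_1 q n by (intro mult_right_mono self_le_power) auto
        also have "\<dots> = ((K + 1) * q) ^ n" by (simp add: power_mult_distrib)
        also have "\<dots> \<le> \<alpha> n ^ n"
          using k0(2)[of n] False R.K_ge_1 q by (intro power_mono) (auto simp: q_def)
        finally show "(K + 1) * q ^ n \<le> \<alpha> n ^ n" .
      qed
      finally show ?thesis using * by simp
    qed
  qed

  have bdd: "bounded (S.x n ` T)" if n: "n \<ge> 1" and T': "bounded T" for n
  proof -
    obtain R where R: "\<And>s. s \<in> T \<Longrightarrow> norm s \<le> R" using T' by (auto simp: bounded_iff)
    have "norm (S.x n s) \<le> \<alpha> n ^ n * max R \<delta>" if s: "s \<in> T" for s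
    proof -
      have "\<alpha> n ^ n * max (norm s) \<delta> \<le> \<alpha> n ^ n * max R \<delta>"
        using \<alpha>n[OF n] R[OF s] by (intro mult_left_mono) auto
      then show ?thesis using growth[OF n s] by linarith
    qed
    then show ?thesis by (auto simp: bounded_iff)
  qed

  have unif: "uniform_limit T (\<lambda>i s. \<sigma> (e i) (S.x n s)) (S.x n) (net_filter L le)" if n: "n \<ge> 1" for n
  proof (rule uniform_limitI)
    fix \<eta> :: real assume \<eta>: "\<eta> > 0"
    have K1: "K + 1 > 0" using R.K_ge_1 by simp
    with \<eta> have "\<eta> / 2 / (K + 1) > 0" by simp
    \<comment> \<open>The stage k is fixed before i, since the tolerance \<eta> / 2 / q demanded of
      \<open>e i\<close> depends on k through q.\<close>
    then obtain k where k: "k \<ge> k0 n" "D n / 2 ^ k < \<eta> / 2 / (K + 1)"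
      by (rule S.small_error)
    have 1: "(K + 1) * (D n / 2 ^ k) < \<eta> / 2"
      using k(2) unfolding pos_less_divide_eq[OF K1] mult.commute[of "K + 1"] .
    define q where "q = K * norm (S.c k ^ n) + 1"
    have "0 \<le> K * norm (S.c k ^ n)" using R.K_ge_1 by simp
    then have q: "q > 0" "K * norm (S.c k ^ n) \<le> q" by (auto simp: q_def)
    have "\<forall>\<^sub>F i in net_filter L le. \<forall>s\<in>T. dist (\<sigma> (e i) s) s < \<eta> / 2 / q"
      using \<eta> q by (intro uniform_limitD[OF ul]) simp
    with eventually_in_net[OF dir]
    show "\<forall>\<^sub>F i in net_filter L le. \<forall>s\<in>T. dist (\<sigma> (e i) (S.x n s)) (S.x n s) < \<eta>"
    proof eventually_elim
      case (elim i)
      show ?case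
      proof
        fix s assume s: "s \<in> T"
        have "norm (\<sigma> (e i) (S.x n s) - S.x n s) \<le>
            (K + 1) * (D n / 2 ^ k) + K * norm (S.c k ^ n) * norm (\<sigma> (e i) s - s)"
          using elim eA A(3) e(2) by (intro S.x_approx n s k) auto
        also have "K * norm (S.c k ^ n) * norm (\<sigma> (e i) s - s) \<le> q * norm (\<sigma> (e i) s - s)"
          by (rule mult_right_mono[OF q(2) norm_ge_zero])
        also have "\<dots> < \<eta> / 2"
          using elim(2) s unfolding dist_norm pos_less_divide_eq[OF q(1)] mult.commute[of q] by blast
        finally show "dist (\<sigma> (e i) (S.x n s)) (S.x n s) < \<eta>"
          using 1 unfolding dist_norm by linarith
      qed
    qed
  qed

  have "simultaneous_power_factorization scale_fun A B 1 L le e scX Y \<sigma> T \<epsilon> \<delta> r n0 \<alpha> S.a S.x"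
    unfolding simultaneous_power_factorization_def Let_def
  proof (intro conjI; (intro allI impI ballI)?)
    show "\<exists>u l. (\<forall>k\<ge>1. l k \<in> L \<and> u k = e (l k)) \<and>
        (\<lambda>i. (r * (1 - r) ^ i) *\<^sub>R u (Suc i)) sums S.a \<and> S.a \<in> closure (convex hull (u ` {1..})) \<and>
        (\<forall>k. (1 - r) ^ k *\<^sub>R 1 + (\<Sum>i=1..k. (r * (1 - r) ^ (i - 1)) *\<^sub>R u i) \<in> convex hull (insert 1 (u ` {1..k})) \<and>
             invertible_in B ((1 - r) ^ k *\<^sub>R 1 + (\<Sum>i=1..k. (r * (1 - r) ^ (i - 1)) *\<^sub>R u i)) \<and>
             inverse_in B ((1 - r) ^ k *\<^sub>R 1 + (\<Sum>i=1..k. (r * (1 - r) ^ (i - 1)) *\<^sub>R u i))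
               \<in> generated_unital_banach_subalgebra scale_fun B (u ` {1..k})) \<and>
        (\<forall>n\<ge>1. \<forall>s\<in>T.
           (\<lambda>k. \<sigma> (inverse_in B ((1 - r) ^ k *\<^sub>R 1 +
                     (\<Sum>i=1..k. (r * (1 - r) ^ (i - 1)) *\<^sub>R u i)) ^ n) s) \<longlonglongrightarrow> S.x n s) \<and>
        (\<forall>k\<ge>1. le (l k) (l (Suc k))) \<and>
        ((\<nexists>m. m \<in> L \<and> (\<forall>i\<in>L. le i m)) \<longrightarrow> (\<forall>k\<ge>1. \<not> le (l (Suc k)) (l k)))"
      by (rule exI[of _ u], rule exI[of _ l], unfold S.b_def[symmetric] S.c_def[symmetric])
         (intro conjI allI impI ballI S.a_sums S.a_in_hull S.b_in_hull S.invertible_b S.c_generated S.x_tendsto l; simp add: l u_def)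
  next
    show "s = \<sigma> (S.a ^ n) (S.x n s)" if "1 \<le> n" "s \<in> T" for n s
      using S.factorization[OF that] by simp
  qed (use a_A S.norm_a close growth bdd unif in
        \<open>simp_all add: S.x_in_Y S.uniformly_continuous_x S.homeomorphism_x S.x_add S.x_scale totally_bounded_image\<close>)
  then show ?thesis
    using a_pos x_YP S.norm_a by blast
qed

theorem theorem5p7:
  fixes A :: "('w discrete \<Rightarrow>\<^sub>C 'f::{real_normed_field,banach}) set"
    and L :: "'l set" and le :: "'l \<Rightarrow> 'l \<Rightarrow> bool" and e :: "'l \<Rightarrow> ('w discrete \<Rightarrow>\<^sub>C 'f)"
    and scX :: "'f \<Rightarrow> 'x::banach \<Rightarrow> 'x" and XP S :: "'x set"
    and \<pi> :: "('w discrete \<Rightarrow>\<^sub>C 'f) \<Rightarrow> 'x \<Rightarrow> 'x"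
  assumes A: "ordered_banach_algebra scale_fun A (nonneg_cone A)"
  shows
    "(self_adjoint A \<longrightarrow>
       (\<exists>(\<Lambda> :: ('w discrete \<Rightarrow>\<^sub>C 'f) set) leq u.
          positive_left_approximate_identity A (nonneg_cone A) 1 \<Lambda> leq u)) \<and>
     (positive_left_approximate_identity A (nonneg_cone A) 1 L le e \<and>
      normed_space_over scX \<and> convex_cone XP \<and> closed XP \<and>
      continuous_representation scale_fun A scX UNIV \<pi> \<and>
      positive_representation (nonneg_cone A) XP \<pi> \<and>
      S \<noteq> {} \<and> S \<subseteq> XP \<and> uniform_limit S (\<lambda>i s. \<pi> (e i) s) (\<lambda>s. s) (net_filter L le)
      \<longrightarrow>
      (let B = normalizer A; Xe = essential_subspace A scX \<pi> in
         unital_ordered_superalgebra scale_fun B (nonneg_cone B) A (nonneg_cone A) \<and>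
         inverse_closed B (nonneg_cone B) \<and>
         S \<subseteq> Xe \<and>
         (\<exists>\<pi>\<^sub>e.
            continuous_representation scale_fun B scX Xe \<pi>\<^sub>e \<and>
            unital_representation Xe \<pi>\<^sub>e \<and>
            positive_representation (nonneg_cone B) (Xe \<inter> XP) \<pi>\<^sub>e \<and>
            (\<forall>a\<in>A. \<forall>y\<in>Xe. \<pi>\<^sub>e a y = \<pi> a y) \<and>
            (\<forall>\<epsilon> \<delta> r n0 \<alpha>.
               \<epsilon> > 0 \<and> \<delta> > 0 \<and> 0 < r \<and> r < 1 / 2 \<and> n0 \<ge> 1 \<and>
               (\<forall>n\<ge>1. \<alpha> n > 1) \<and> filterlim \<alpha> at_top sequentially \<longrightarrow>
               (\<exists>a x.
                  simultaneous_power_factorization scale_fun A B 1 L le e scX Xe \<pi>\<^sub>e S \<epsilon> \<delta> r n0 \<alpha> a x \<and>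
                  a \<in> nonneg_cone A \<and>
                  (\<forall>n\<ge>1. x n ` S \<subseteq> Xe \<inter> XP) \<and>
                  norm a \<le> 1)))))"
proof (rule conjI; intro impI; (elim conjE)?)
  have sub: "subalgebra_over scale_fun A" and cl: "closed A"
    using A by (auto simp: ordered_banach_algebra_def complete_eq_closed)
  show "\<exists>(\<Lambda> :: ('w discrete \<Rightarrow>\<^sub>C 'f) set) leq u.
      positive_left_approximate_identity A (nonneg_cone A) 1 \<Lambda> leq u" if "self_adjoint A"
    by (rule positive_left_approximate_identity_exists[OF sub cl that])

  assume ai: "positive_left_approximate_identity A (nonneg_cone A) 1 L le e"
    and sp: "normed_space_over scX" and XP: "convex_cone XP" "closed XP"
    and rep: "continuous_representation scale_fun A scX UNIV \<pi>"
    and pos: "positive_representation (nonneg_cone A) XP \<pi>"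
    and S: "S \<noteq> {}" "S \<subseteq> XP" and ul: "uniform_limit S (\<lambda>i s. \<pi> (e i) s) (\<lambda>s. s) (net_filter L le)"
  obtain K where "bounded_representation A scX UNIV \<pi> K"
    by (rule bounded_representation_exists[OF sub sp rep])
  then interpret E: essential_representation A scX \<pi> K L le e
    using ai by (simp add: essential_representation_def essential_representation_axioms_def positive_left_approximate_identity_def)
  define B where "B = normalizer A"
  define Xe where "Xe = essential_subspace A scX \<pi>"
  have subB: "subalgebra_over scale_fun B" and clB: "closed B" and AB: "A \<subseteq> B" and one: "1 \<in> B"
    unfolding B_def by (simp_all add: subalgebra_normalizer closed_normalizer subset_normalizer one_in_normalizer sub cl)
  have e_pos: "\<And>i. i \<in> L \<Longrightarrow> e i \<in> nonneg_cone A"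
    using ai by (simp add: positive_left_approximate_identity_def)
  have super: "unital_ordered_superalgebra scale_fun B (nonneg_cone B) A (nonneg_cone A)"
    unfolding unital_ordered_superalgebra_def
    using ordered_banach_algebra_nonneg_cone[OF subB clB] A one AB cl by (auto simp: nonneg_cone_def)
  \<comment> \<open>Each s in \<open>S\<close> is the limit of the vectors
    \<open>\<pi> (e i) s\<close>, which lie in the closed subspace \<open>Xe\<close>.\<close>
  have S_Xe: "S \<subseteq> Xe"
  proof
    fix s assume s: "s \<in> S"
    show "s \<in> Xe"
      unfolding Xe_def
      by (rule Lim_in_closed_set[OF E.closed_Xe _ E.F_neq_bot tendsto_uniform_limitI[OF ul s]])
         (use E.eventually_L in \<open>auto elim!: eventually_mono intro: E.in_Xe E.e_in\<close>)
  qed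
  have rep_e: "continuous_representation scale_fun B scX Xe E.ext"
    and unital_e: "unital_representation Xe E.ext"
    and pos_e: "positive_representation (nonneg_cone B) (Xe \<inter> XP) E.ext"
    and ext_eq: "\<And>a y. a \<in> A \<Longrightarrow> y \<in> Xe \<Longrightarrow> E.ext a y = \<pi> a y"
    unfolding B_def Xe_def
    by (simp_all add: E.continuous_representation_ext unital_representation_def E.ext_one
        E.ext_positive[OF XP(2) pos e_pos] E.ext_eq)
  obtain K' where K': "bounded_representation B scX Xe E.ext K'"
    by (rule bounded_representation_exists[OF subB sp rep_e])
  have "\<forall>\<^sub>F i in net_filter L le. \<forall>s\<in>S. \<pi> (e i) s = E.ext (e i) s"
    using E.eventually_L by eventually_elim (use ext_eq E.e_in S_Xe in auto)
  then have ul_e: "uniform_limit S (\<lambda>i s. E.ext (e i) s) (\<lambda>s. s) (net_filter L le)"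
    using uniform_limit_cong[of S "\<lambda>i s. \<pi> (e i) s" "\<lambda>i s. E.ext (e i) s" "net_filter L le" "\<lambda>s. s" "\<lambda>s. s"] ul
    by simp
  have closed: "closed (Xe \<inter> XP)"
    unfolding Xe_def using E.closed_Xe XP(2) by (rule closed_Int)
  have "\<exists>a x. simultaneous_power_factorization scale_fun A B 1 L le e scX Xe E.ext S \<epsilon> \<delta> r n0 \<alpha> a x \<and>
      a \<in> nonneg_cone A \<and> (\<forall>n\<ge>1. x n ` S \<subseteq> Xe \<inter> XP) \<and> norm a \<le> 1"
    if "\<epsilon> > 0" "\<delta> > 0" "0 < r" "r < 1 / 2" "\<forall>n\<ge>1. \<alpha> n > 1" "filterlim \<alpha> at_top sequentially"
    for \<epsilon> \<delta> r n0 \<alpha>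
    by (rule simultaneous_power_factorization_exists[OF K' clB one unital_e sub cl AB ai _ _ closed pos_e ul_e])
       (use that S S_Xe in auto)
  then show "let B = normalizer A; Xe = essential_subspace A scX \<pi> in
         unital_ordered_superalgebra scale_fun B (nonneg_cone B) A (nonneg_cone A) \<and>
         inverse_closed B (nonneg_cone B) \<and>
         S \<subseteq> Xe \<and>
         (\<exists>\<pi>\<^sub>e.
            continuous_representation scale_fun B scX Xe \<pi>\<^sub>e \<and>
            unital_representation Xe \<pi>\<^sub>e \<and>
            positive_representation (nonneg_cone B) (Xe \<inter> XP) \<pi>\<^sub>e \<and>
            (\<forall>a\<in>A. \<forall>y\<in>Xe. \<pi>\<^sub>e a y = \<pi> a y) \<and>
            (\<forall>\<epsilon> \<delta> r n0 \<alpha>.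
               \<epsilon> > 0 \<and> \<delta> > 0 \<and> 0 < r \<and> r < 1 / 2 \<and> n0 \<ge> 1 \<and>
               (\<forall>n\<ge>1. \<alpha> n > 1) \<and> filterlim \<alpha> at_top sequentially \<longrightarrow>
               (\<exists>a x.
                  simultaneous_power_factorization scale_fun A B 1 L le e scX Xe \<pi>\<^sub>e S \<epsilon> \<delta> r n0 \<alpha> a x \<and>
                  a \<in> nonneg_cone A \<and>
                  (\<forall>n\<ge>1. x n ` S \<subseteq> Xe \<inter> XP) \<and>
                  norm a \<le> 1)))"
    unfolding Let_def B_def[symmetric] Xe_def[symmetric]
    by (intro conjI exI[of _ E.ext] super inverse_closed_nonneg_cone S_Xe rep_e unital_e pos_e ballI allI impI ext_eq; (elim conjE)?) blast+
qed

end
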